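(* The B-Z constant for the family of $3\times n$ grid graphs exists and equals $$\lim_{n\to\infty}\frac{\sum_{T\in\mathcal{T}(P_3\times P_n)}|\mathcal{L}(T)|}{3n\cdot\tau(P_3\times P_n)}=\frac{-10500 + 2200 \sqrt{21} + 1197 \sqrt{230 - 50 \sqrt{21}} + 149 \sqrt{210 (23 - 5 \sqrt{21})}}{5040}.$$
   Context: All graphs are finite and simple. The $a\times b$ grid graph $P_a\times P_b$ has vertex set $\{(i,j): 1\le i\le a,\ 1\le j\le b\}$, and $(u_1,u_2)$ and $(v_1,v_2)$ are adjacent iff either $|u_1-v_1|=1$ and $u_2=v_2$, or $u_1=v_1$ and $|u_2-v_2|=1$. $\mathcal{T}(G)$ is the set of labeled spanning trees of $G$, $\tau(G)=|\mathcal{T}(G)|$, and $\mathcal{L}(T)$ is the set of leaves (vertices of degree exactly $1$ in $T$) of a tree $T$. The B-Z constant of a graph family (with members indexed by number of vertices) is the limit of $\frac{\sum_{T\in\mathcal{T}(G)}|\mathcal{L}(T)|}{|V(G)|\,\tau(G)}$ as $|V(G)|\to\infty$ along members $G$ of the family, whenever the limit exists. *)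

theory Defs
  imports Complex_Main
begin

record 'a ugraph =
  verts :: "'a set"
  edges :: "'a set set"

definition simple_graph :: "'a ugraph \<Rightarrow> bool" where
  "simple_graph G \<longleftrightarrow> finite (verts G) \<and> (\<forall>e\<in>edges G. e \<subseteq> verts G \<and> card e = 2)"

definition connected_graph :: "'a ugraph \<Rightarrow> bool" where
  "connected_graph G \<longleftrightarrow> verts G \<noteq> {} \<and>
     (\<forall>u\<in>verts G. \<forall>v\<in>verts G. (u, v) \<in> {(x, y). {x, y} \<in> edges G}\<^sup>*)"

text \<open>A cycle is given by the list of its distinct vertices; the edge joining the last vertex
  to the first closes it.\<close>

definition is_cycle :: "'a ugraph \<Rightarrow> 'a list \<Rightarrow> bool" where
  "is_cycle G p \<longleftrightarrow> length p \<ge> 3 \<and> distinct p \<and>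
     (\<forall>i. Suc i < length p \<longrightarrow> {p ! i, p ! Suc i} \<in> edges G) \<and> {last p, hd p} \<in> edges G"

definition is_tree :: "'a ugraph \<Rightarrow> bool" where
  "is_tree T \<longleftrightarrow> simple_graph T \<and> connected_graph T \<and> (\<nexists>p. is_cycle T p)"

text \<open>Labeled spanning trees: trees count as different as soon as their edge sets differ.\<close>

definition spanning_trees :: "'a ugraph \<Rightarrow> 'a ugraph set" where
  "spanning_trees G = {T. is_tree T \<and> verts T = verts G \<and> edges T \<subseteq> edges G}"

definition num_spanning_trees :: "'a ugraph \<Rightarrow> nat" where
  "num_spanning_trees G = card (spanning_trees G)"

definition degree :: "'a ugraph \<Rightarrow> 'a \<Rightarrow> nat" where
  "degree G v = card {e \<in> edges G. v \<in> e}"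

definition leaves :: "'a ugraph \<Rightarrow> 'a set" where
  "leaves T = {v \<in> verts T. degree T v = 1}"

definition bz_ratio :: "'a ugraph \<Rightarrow> real" where
  "bz_ratio G = real (\<Sum>T\<in>spanning_trees G. card (leaves T)) /
     (real (card (verts G)) * real (num_spanning_trees G))"

text \<open>The limit runs over all members of the family as their number of vertices tends to
  infinity. The first conjunct makes this limit process non-trivial, so that the constant
  is unique.\<close>

definition is_BZ_constant :: "'a ugraph set \<Rightarrow> real \<Rightarrow> bool" where
  "is_BZ_constant F c \<longleftrightarrow> (\<forall>N. \<exists>G\<in>F. card (verts G) \<ge> N) \<and>
     (bz_ratio \<longlongrightarrow> c) (inf (filtercomap (\<lambda>G. card (verts G)) at_top) (principal F))"

text \<open>Coordinates are cast to \<^typ>\<open>int\<close> since subtraction on \<^typ>\<open>nat\<close> truncates.\<close>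

definition grid_adj :: "nat \<times> nat \<Rightarrow> nat \<times> nat \<Rightarrow> bool" where
  "grid_adj u v \<longleftrightarrow>
     (\<bar>int (fst u) - int (fst v)\<bar> = 1 \<and> snd u = snd v) \<or>
     (fst u = fst v \<and> \<bar>int (snd u) - int (snd v)\<bar> = 1)"

definition grid :: "nat \<Rightarrow> nat \<Rightarrow> (nat \<times> nat) ugraph" where
  "grid a b = \<lparr>verts = {1..a} \<times> {1..b},
     edges = {{u, v} | u v. u \<in> {1..a} \<times> {1..b} \<and> v \<in> {1..a} \<times> {1..b} \<and> grid_adj u v}\<rparr>"

lemma card_verts_grid: "card (verts (grid a b)) = a * b"
  by (simp add: grid_def)

lemma simple_graph_grid: "simple_graph (grid a b)"
  by (auto simp: simple_graph_def grid_def grid_adj_def card_insert_if)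

lemma finite_spanning_trees:
  assumes "simple_graph G"
  shows "finite (spanning_trees G)"
proof -
  have "edges G \<subseteq> Pow (verts G)" "finite (verts G)"
    using assms by (auto simp: simple_graph_def)
  then have "finite (edges G)"
    by (meson finite_Pow_iff finite_subset)
  moreover have "spanning_trees G \<subseteq> (\<lambda>E. \<lparr>verts = verts G, edges = E\<rparr>) ` Pow (edges G)"
    by (auto simp: spanning_trees_def image_iff intro!: bexI[of _ "edges _"] ugraph.equality)
  ultimately show ?thesis
    by (meson finite_Pow_iff finite_imageI finite_subset)
qed

lemma is_BZ_constant_unique:
  assumes "is_BZ_constant F c" "is_BZ_constant F d"
  shows "c = d"
proof (rule tendsto_unique)
  show "inf (filtercomap (\<lambda>G. card (verts G)) at_top) (principal F) \<noteq> bot"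
    using assms(1)
    by (auto simp: is_BZ_constant_def trivial_limit_def eventually_inf_principal
        eventually_filtercomap_at_top_linorder)
qed (use assms in \<open>auto simp: is_BZ_constant_def\<close>)

end

theory Submission
  imports Defs
begin

text \<open>
  A spanning tree of a graph in which the vertex v is a leaf consists of one edge at v and a
  spanning tree of the graph without v. Hence the total number of leaves is the sum of
  deg v times the number of spanning trees that remain after the deletion of v
  (\<open>sum_card_leaves\<close>, \<open>card_trees_with_leaf\<close>), and the theorem is a statement about how many
  spanning trees a 3 by n grid keeps when one vertex is deleted.

  Trees are counted by deletion and contraction (\<open>card_tree_extensions\<close>). Applied to the edges of
  the last column, this turns the grid into the grid with one column less, whose last three
  vertices may have been glued together. So a partially treated grid is described by five
  numbers, one for each way of gluing three vertices (\<open>frontier3\<close>), and a complete column acts on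
  them by a fixed matrix. The eigenvalues of this matrix that matter are products of a root of
  x + 1/x = 3 and a root of x + 1/x = 5; the right-hand sides are 2 + 1 and 2 + 3, where 1 and 3 are
  the nonzero Laplace eigenvalues of the path on three vertices. This is why all counts are
  bilinear in the two sequences \<open>lucas_seq 3\<close> and \<open>lucas_seq 5\<close>; the n columns together have
  \<open>lucas_seq 3 n * lucas_seq 5 n\<close> spanning trees.

  When a vertex of an inner column is deleted, the columns to its left contribute the vector of
  counts of a shorter grid (\<open>frontier3_strip\<close>), the columns to its right contribute a linear
  functional of it (\<open>tree_count_add_columns\<close>), and the mutilated column couples the two
  (\<open>leaf_count_outer_rows\<close>, \<open>leaf_count_middle_row_row\<close>). With \<open>\<alpha> = (3 + sqrt 5) / 2\<close> and
  \<open>\<beta> = (5 + sqrt 21) / 2\<close> both parts grow like powers of \<open>\<alpha> * \<beta>\<close>, so the sum over all columns is a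
  convolution of two sequences that converge after normalization, and its mean tends to the
  product of the limits (\<open>convolution_mean_tendsto\<close>). The two outermost columns have at most six
  leaves per tree, which is negligible. What is left is an identity in the field generated
  by sqrt 5 and sqrt 21 (\<open>leaf_constant\<close>); the nested radicals of the constant denest in this field.
\<close>

section \<open>Connectivity and forests\<close>

definition edge :: "'v \<times> 'v \<Rightarrow> 'v set" where
  "edge e = {fst e, snd e}"

definition conn :: "'v set set \<Rightarrow> ('v \<times> 'v) set" where
  "conn F = {(x, y). {x, y} \<in> F}\<^sup>*"

definition forest :: "'v set set \<Rightarrow> bool" where
  "forest F \<longleftrightarrow> (\<nexists>p. is_cycle \<lparr>verts = {}, edges = F\<rparr> p)"

abbreviation tree_on :: "'v set \<Rightarrow> 'v set set \<Rightarrow> bool" where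
  "tree_on V F \<equiv> is_tree \<lparr>verts = V, edges = F\<rparr>"

lemma tree_on_iff:
  "tree_on V F \<longleftrightarrow> finite V \<and> V \<noteq> {} \<and> (\<forall>e\<in>F. e \<subseteq> V \<and> card e = 2) \<and>
     (\<forall>u\<in>V. \<forall>v\<in>V. (u, v) \<in> conn F) \<and> forest F"
  by (auto simp: is_tree_def simple_graph_def connected_graph_def forest_def is_cycle_def conn_def)

lemma conn_refl [simp]: "(x, x) \<in> conn F"
  by (simp add: conn_def)

lemma conn_edge: "{x, y} \<in> F \<Longrightarrow> (x, y) \<in> conn F"
  unfolding conn_def by (rule r_into_rtrancl) auto

lemma conn_trans: "(x, y) \<in> conn F \<Longrightarrow> (y, z) \<in> conn F \<Longrightarrow> (x, z) \<in> conn F"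
  unfolding conn_def by (rule rtrancl_trans)

lemma conn_induct [consumes 1, case_names base step]:
  assumes "(x, y) \<in> conn F" "P x"
    and "\<And>y z. (x, y) \<in> conn F \<Longrightarrow> {y, z} \<in> F \<Longrightarrow> P y \<Longrightarrow> P z"
  shows "P y"
  using assms(1) unfolding conn_def
  by (induction rule: rtrancl_induct) (use assms(2,3) in \<open>auto simp: conn_def\<close>)

lemma conn_sym: "(x, y) \<in> conn F \<Longrightarrow> (y, x) \<in> conn F"
proof (induction rule: conn_induct)
  case (step y z)
  then have "(z, y) \<in> conn F" by (intro conn_edge) (simp add: insert_commute)
  then show ?case using step.IH by (rule conn_trans)
qed simp

lemma conn_mono: "(x, y) \<in> conn F \<Longrightarrow> F \<subseteq> G \<Longrightarrow> (x, y) \<in> conn G"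
proof (induction rule: conn_induct)
  case (step y z)
  then have "(y, z) \<in> conn G" by (intro conn_edge) auto
  with step.IH step.prems show ?case by (blast intro: conn_trans)
qed simp

lemma conn_empty [simp]: "(x, y) \<in> conn {} \<longleftrightarrow> x = y"
  by (auto simp: conn_def)

lemma conn_insert_iff:
  "(x, y) \<in> conn (insert {u, v} F) \<longleftrightarrow> (x, y) \<in> conn F \<or>
     (x, u) \<in> conn F \<and> (v, y) \<in> conn F \<or> (x, v) \<in> conn F \<and> (u, y) \<in> conn F"
  (is "_ \<longleftrightarrow> ?R y")
proof
  assume "(x, y) \<in> conn (insert {u, v} F)"
  then show "?R y"
  proof (induction rule: conn_induct)
    case (step y z)
    from step.hyps(2) consider "(y, z) \<in> conn F" | "y = u" "z = v" | "y = v" "z = u"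
      by (auto simp: doubleton_eq_iff intro: conn_edge)
    then show ?case
    proof cases
      case 1
      then show ?thesis using step.IH conn_trans[of x y F z] conn_trans[of u y F z]
        conn_trans[of v y F z] by blast
    next
      case 2
      then show ?thesis using step.IH conn_refl[of v F] conn_trans[of x v F u]
        conn_sym[of u v F] by blast
    next
      case 3
      then show ?thesis using step.IH conn_refl[of u F] conn_trans[of x u F v]
        conn_sym[of v u F] by blast
    qed
  qed simp
next
  let ?G = "insert {u, v} F"
  have uv: "(u, v) \<in> conn ?G" by (rule conn_edge) auto
  have up: "(a, b) \<in> conn ?G" if "(a, b) \<in> conn F" for a b
    using conn_mono[OF that] by blast
  assume "?R y"
  then consider "(x, y) \<in> conn F" | "(x, u) \<in> conn F" "(v, y) \<in> conn F"
    | "(x, v) \<in> conn F" "(u, y) \<in> conn F" by blast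
  then show "(x, y) \<in> conn ?G"
  proof cases
    case 1
    then show ?thesis by (rule up)
  next
    case 2
    show ?thesis by (rule conn_trans[OF conn_trans[OF up[OF 2(1)] uv] up[OF 2(2)]])
  next
    case 3
    show ?thesis by (rule conn_trans[OF conn_trans[OF up[OF 3(1)] conn_sym[OF uv]] up[OF 3(2)]])
  qed
qed

text \<open>
  A walk becomes a path by cutting it back to the first visit whenever it returns to a
  vertex.
\<close>

lemma conn_simple_path:
  assumes "(x, y) \<in> conn F"
  shows "\<exists>p. p \<noteq> [] \<and> hd p = x \<and> last p = y \<and> distinct p \<and>
           (\<forall>i. Suc i < length p \<longrightarrow> {p ! i, p ! Suc i} \<in> F)"
  using assms
proof (induction rule: conn_induct)
  case base
  show ?case by (rule exI[of _ "[x]"]) simp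
next
  case (step y z)
  then obtain p where p: "p \<noteq> []" "hd p = x" "last p = y" "distinct p"
    "\<forall>i. Suc i < length p \<longrightarrow> {p ! i, p ! Suc i} \<in> F" by blast
  show ?case
  proof (cases "z \<in> set p")
    case True
    then obtain k where k: "k < length p" "p ! k = z" by (auto simp: in_set_conv_nth)
    have "hd (take (Suc k) p) = x" using p by (simp add: hd_conv_nth)
    moreover have "last (take (Suc k) p) = z" using k by (simp add: take_Suc_conv_app_nth)
    ultimately show ?thesis
      using p k by (intro exI[of _ "take (Suc k) p"] conjI allI impI) simp_all
  next
    case False
    have "{(p @ [z]) ! i, (p @ [z]) ! Suc i} \<in> F" if i: "Suc i < length (p @ [z])" for i
    proof (cases "Suc i < length p")
      case True
      then show ?thesis using p by (simp add: nth_append)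
    next
      case False
      then have "i = length p - 1" "Suc i = length p" using i p(1) by auto
      then show ?thesis using p step.hyps(2) by (simp add: nth_append last_conv_nth)
    qed
    then show ?thesis using p False by (intro exI[of _ "p @ [z]"] conjI allI impI) simp_all
  qed
qed

lemma conn_along_list:
  assumes "\<And>k. i \<le> k \<Longrightarrow> k < j \<Longrightarrow> {p ! k, p ! Suc k} \<in> F" "i \<le> j"
  shows "(p ! i, p ! j) \<in> conn F"
  using assms(2,1)
proof (induction j rule: dec_induct)
  case base
  then show ?case by simp
next
  case (step m)
  have "(p ! i, p ! m) \<in> conn F" using step by simp
  moreover have "(p ! m, p ! Suc m) \<in> conn F" using step by (intro conn_edge) auto
  ultimately show ?case by (rule conn_trans)
qed

text \<open>
  A path from u to v in F, closed by the new edge, is a cycle; its length is at least three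
  because the edge itself is not in F. Conversely, a cycle that uses the new edge leaves,
  after the removal of this edge, a walk in F between its ends.
\<close>

lemma forest_insert_iff:
  assumes "u \<noteq> v" "{u, v} \<notin> F"
  shows "forest (insert {u, v} F) \<longleftrightarrow> forest F \<and> (u, v) \<notin> conn F"
proof (intro iffI conjI)
  assume f: "forest (insert {u, v} F)"
  then show "forest F" by (auto simp: forest_def is_cycle_def)
  show "(u, v) \<notin> conn F"
  proof
    assume "(u, v) \<in> conn F"
    then obtain p where p: "p \<noteq> []" "hd p = u" "last p = v" "distinct p"
      "\<forall>i. Suc i < length p \<longrightarrow> {p ! i, p ! Suc i} \<in> F" using conn_simple_path by metis
    have "length p \<ge> 3"
    proof (rule ccontr)
      assume "\<not> length p \<ge> 3"
      then have "length p = 1 \<or> length p = 2" using p(1)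
        by (cases "length p") auto
      then show False
      proof
        assume "length p = 1"
        then show False using p assms by (auto simp: length_Suc_conv)
      next
        assume l: "length p = 2"
        then have "p ! 0 = u" "p ! 1 = v" using p by (auto simp: hd_conv_nth last_conv_nth)
        then show False using p(5)[rule_format, of 0] l assms by simp
      qed
    qed
    then have "is_cycle \<lparr>verts = {}, edges = insert {u, v} F\<rparr> p"
      using p by (auto simp: is_cycle_def insert_commute)
    then show False using f by (auto simp: forest_def)
  qed
next
  assume "forest F \<and> (u, v) \<notin> conn F"
  then have f: "forest F" and nc: "(u, v) \<notin> conn F" by auto
  show "forest (insert {u, v} F)"
    unfolding forest_def
  proof
    assume "\<exists>p. is_cycle \<lparr>verts = {}, edges = insert {u, v} F\<rparr> p"
    then obtain p where len: "length p \<ge> 3" and d: "distinct p"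
      and st: "\<And>i. Suc i < length p \<Longrightarrow> {p ! i, p ! Suc i} \<in> insert {u, v} F"
      and cl: "{last p, hd p} \<in> insert {u, v} F"
      unfolding is_cycle_def by auto
    let ?l = "length p - 1"
    have ends: "hd p = p ! 0" "last p = p ! ?l"
      using len by (auto simp: hd_conv_nth last_conv_nth simp flip: length_greater_0_conv)
    have nth_eq: "p ! i = p ! j \<longleftrightarrow> i = j" if "i < length p" "j < length p" for i j
      using d that by (simp add: nth_eq_iff_index_eq)
    have "\<exists>i j. (p ! i, p ! j) \<in> conn F \<and> {p ! i, p ! j} = {u, v}"
    proof (cases "{last p, hd p} = {u, v}")
      case True
      have "(p ! 0, p ! ?l) \<in> conn F"
      proof (rule conn_along_list)
        fix k assume k: "k < ?l"
        then have "Suc k < length p" by linarith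
        moreover have "p \<noteq> []" using len by auto
        ultimately have "p ! Suc k \<noteq> p ! 0" using nth_eq[of "Suc k" 0] by simp
        moreover have "p ! Suc k \<noteq> p ! ?l" if "p ! k = p ! 0"
        proof -
          have "k = 0" using that nth_eq[of k 0] \<open>Suc k < length p\<close> \<open>p \<noteq> []\<close> by simp
          then show ?thesis using nth_eq[of "Suc k" ?l] len by auto
        qed
        ultimately have "{p ! k, p ! Suc k} \<noteq> {last p, hd p}"
          unfolding ends by (metis doubleton_eq_iff)
        then show "{p ! k, p ! Suc k} \<in> F" using st[of k] k True by auto
      qed simp
      then show ?thesis using True unfolding ends
        by (intro exI[of _ 0] exI[of _ ?l]) (simp add: insert_commute)
    next
      case False
      then have clF: "{last p, hd p} \<in> F" using cl by auto
      have "\<exists>i. Suc i < length p \<and> {p ! i, p ! Suc i} = {u, v}"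
      proof (rule ccontr)
        assume "\<not> ?thesis"
        then have "is_cycle \<lparr>verts = {}, edges = F\<rparr> p"
          using len d st clF by (auto simp: is_cycle_def)
        then show False using f by (auto simp: forest_def)
      qed
      then obtain i where i: "Suc i < length p" "{p ! i, p ! Suc i} = {u, v}" by blast
      have inF: "{p ! k, p ! Suc k} \<in> F" if "Suc k < length p" "k \<noteq> i" for k
      proof -
        have "{p ! k, p ! Suc k} \<noteq> {p ! i, p ! Suc i}"
          using that i(1) by (auto simp: doubleton_eq_iff nth_eq)
        then show ?thesis using st[of k] that i by auto
      qed
      have "(p ! 0, p ! i) \<in> conn F" by (rule conn_along_list) (use inF i in auto)
      moreover have "(p ! Suc i, p ! ?l) \<in> conn F"
        by (rule conn_along_list) (use inF i in auto)
      moreover have "(p ! ?l, p ! 0) \<in> conn F"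
        using clF ends by (intro conn_edge) auto
      ultimately have "(p ! Suc i, p ! i) \<in> conn F" by (meson conn_trans)
      then show ?thesis using i(2)
        by (intro exI[of _ "Suc i"] exI[of _ i]) (simp add: insert_commute)
    qed
    then obtain i j where "(p ! i, p ! j) \<in> conn F" "{p ! i, p ! j} = {u, v}" by blast
    then show False using nc conn_sym[of v u F] by (auto simp: doubleton_eq_iff)
  qed
qed

section \<open>Counting spanning trees by deletion and contraction\<close>

definition sub :: "'v \<Rightarrow> 'v \<Rightarrow> 'v \<Rightarrow> 'v" where
  "sub a b x = (if x = a then b else x)"

abbreviation relabel :: "('v \<Rightarrow> 'w) \<Rightarrow> ('v \<times> 'v) list \<Rightarrow> ('w \<times> 'w) list" where
  "relabel f \<equiv> map (map_prod f f)"

text \<open>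
  The number of spanning trees of a multigraph with k vertices, which is given by the list of
  its edges. Loops and parallel edges are allowed, since contraction creates them. Storing
  only the number of vertices, and not their names, keeps contraction a plain renaming; a
  vertex without edges shows as an excess of k over the number of labels, which forces the
  value 0 if k is at least 2 (\<open>tree_count_eq_0\<close>).
\<close>

function tree_count :: "('v \<times> 'v) list \<Rightarrow> nat \<Rightarrow> nat" where
  "tree_count [] k = (if k = 1 then 1 else 0)"
| "tree_count ((a, b) # es) k = tree_count es k +
     (if a = b then 0 else tree_count (relabel (sub a b) es) (k - 1))"
  by pat_completeness auto
termination by (relation "measure (\<lambda>(es, k). length es)") auto

text \<open>
  The induction over the edges has to remember the edges that were already chosen. They form
  the forest C, and \<open>\<sigma>\<close> names its components. An edge within a component can never be added; an
  edge between two components is either left out, or joins C and merges their names, which is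
  the contraction of the multigraph seen through \<open>\<sigma>\<close>.
\<close>

lemma card_tree_extensions:
  fixes \<sigma> :: "'v \<Rightarrow> 'v"
  assumes "finite V" "V \<noteq> {}" "forest C" "\<forall>e\<in>C. e \<subseteq> V \<and> card e = 2"
    and "\<And>x y. x \<in> V \<Longrightarrow> y \<in> V \<Longrightarrow> \<sigma> x = \<sigma> y \<longleftrightarrow> (x, y) \<in> conn C"
    and "distinct (map edge es)" "C \<inter> edge ` set es = {}"
    and "\<forall>(u, v)\<in>set es. u \<in> V \<and> v \<in> V \<and> u \<noteq> v"
  shows "card {F. F \<subseteq> edge ` set es \<and> tree_on V (C \<union> F)} =
           tree_count (relabel \<sigma> es) (card (\<sigma> ` V))"
  using assms(3-)
proof (induction es arbitrary: C \<sigma>)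
  case Nil
  have "tree_on V C \<longleftrightarrow> card (\<sigma> ` V) = 1"
  proof -
    have "(\<forall>u\<in>V. \<forall>v\<in>V. (u, v) \<in> conn C) \<longleftrightarrow> (\<forall>u\<in>V. \<forall>v\<in>V. \<sigma> u = \<sigma> v)"
      by (intro ball_cong refl) (metis Nil(3))
    also have "\<dots> \<longleftrightarrow> card (\<sigma> ` V) = 1"
    proof
      assume *: "\<forall>u\<in>V. \<forall>v\<in>V. \<sigma> u = \<sigma> v"
      obtain w where "w \<in> V" using assms(2) by blast
      then have "\<sigma> ` V = {\<sigma> w}" using * by blast
      then show "card (\<sigma> ` V) = 1" by simp
    next
      assume "card (\<sigma> ` V) = 1"
      then obtain c where "\<sigma> ` V = {c}" by (auto simp: card_1_singleton_iff)
      then have "\<sigma> x = c" if "x \<in> V" for x using that by blast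
      then show "\<forall>u\<in>V. \<forall>v\<in>V. \<sigma> u = \<sigma> v" by simp
    qed
    finally show ?thesis using Nil assms(1,2) by (simp add: tree_on_iff)
  qed
  then have "{F. F \<subseteq> edge ` set [] \<and> tree_on V (C \<union> F)} =
      (if card (\<sigma> ` V) = 1 then {{}} else {})" by auto
  then show ?case by simp
next
  case (Cons e es)
  obtain u v where e: "e = (u, v)" by (cases e)
  let ?e = "{u, v}" and ?E = "edge ` set es"
  have uv: "u \<in> V" "v \<in> V" "u \<noteq> v" and eE: "?e \<notin> ?E" and eC: "?e \<notin> C"
    using Cons.prems e by (auto simp: edge_def)
  let ?A = "{F. F \<subseteq> ?E \<and> tree_on V (C \<union> F)}"
  let ?B = "{F. F \<subseteq> ?E \<and> tree_on V (insert ?e C \<union> F)}"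
  have fin: "finite ?A" "finite ?B" by (auto intro: finite_subset[of _ "Pow ?E"])
  have "{F. F \<subseteq> edge ` set (e # es) \<and> tree_on V (C \<union> F)} = ?A \<union> insert ?e ` ?B"
  proof (intro equalityI subsetI)
    fix F assume F: "F \<in> {F. F \<subseteq> edge ` set (e # es) \<and> tree_on V (C \<union> F)}"
    show "F \<in> ?A \<union> insert ?e ` ?B"
    proof (cases "?e \<in> F")
      case True
      then have "F = insert ?e (F - {?e})" "insert ?e C \<union> (F - {?e}) = C \<union> F" by auto
      then have "F - {?e} \<in> ?B" using F e by (auto simp: edge_def)
      then show ?thesis using \<open>F = insert ?e (F - {?e})\<close> by blast
    next
      case False
      then show ?thesis using F e by (auto simp: edge_def)
    qed
  qed (use e in \<open>auto simp: edge_def\<close>)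
  moreover have "?A \<inter> insert ?e ` ?B = {}" using eE by auto
  moreover have "inj_on (insert ?e) ?B"
  proof (rule inj_onI)
    fix F G assume "F \<in> ?B" "G \<in> ?B" "insert ?e F = insert ?e G"
    moreover from this eE have "?e \<notin> F" "?e \<notin> G" by auto
    ultimately show "F = G" by (metis insert_ident)
  qed
  ultimately have split: "card {F. F \<subseteq> edge ` set (e # es) \<and> tree_on V (C \<union> F)} = card ?A + card ?B"
    using fin by (simp add: card_Un_disjoint card_image)
  have A: "card ?A = tree_count (relabel \<sigma> es) (card (\<sigma> ` V))"
    using Cons.prems by (intro Cons.IH) auto
  show ?case
  proof (cases "\<sigma> u = \<sigma> v")
    case True
    then have "(u, v) \<in> conn C" using Cons.prems(3) uv by blast
    then have "\<not> forest (insert ?e C \<union> F)" for F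
      using forest_insert_iff[of u v C] uv eC by (auto simp: forest_def is_cycle_def)
    then have "?B = {}" by (auto simp: tree_on_iff)
    then show ?thesis using split A True e by simp
  next
    case False
    then have nc: "(u, v) \<notin> conn C" using Cons.prems(3) uv by blast
    let ?s = "sub (\<sigma> u) (\<sigma> v) \<circ> \<sigma>"
    have "card ?B = tree_count (relabel ?s es) (card (?s ` V))"
    proof (rule Cons.IH)
      show "forest (insert ?e C)" using forest_insert_iff[of u v C] uv eC nc Cons.prems(1) by auto
      show "\<forall>e\<in>insert ?e C. e \<subseteq> V \<and> card e = 2" using Cons.prems(2) uv by auto
      show "?s x = ?s y \<longleftrightarrow> (x, y) \<in> conn (insert ?e C)" if xy: "x \<in> V" "y \<in> V" for x y
        unfolding conn_insert_iff Cons.prems(3)[OF xy, symmetric]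
          Cons.prems(3)[OF xy(1) uv(1), symmetric] Cons.prems(3)[OF xy(1) uv(2), symmetric]
          Cons.prems(3)[OF uv(1) xy(2), symmetric] Cons.prems(3)[OF uv(2) xy(2), symmetric]
        using False by (auto simp: sub_def)
      show "distinct (map edge es)" "\<forall>(u, v)\<in>set es. u \<in> V \<and> v \<in> V \<and> u \<noteq> v"
        using Cons.prems by auto
      show "insert ?e C \<inter> ?E = {}" using Cons.prems eE by auto
    qed
    \<comment> \<open>The merged component gives up its name \<open>\<sigma> u\<close>, so the number of components drops by one.\<close>
    also have "?s ` V = \<sigma> ` V - {\<sigma> u}" using False uv by (auto simp: sub_def)
    also have "relabel ?s es = relabel (sub (\<sigma> u) (\<sigma> v)) (relabel \<sigma> es)"
      by (simp add: map_prod.comp)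
    also have "card (\<sigma> ` V - {\<sigma> u}) = card (\<sigma> ` V) - 1"
      using uv assms(1) by simp
    finally have "card ?B = tree_count (relabel (sub (\<sigma> u) (\<sigma> v)) (relabel \<sigma> es))
      (card (\<sigma> ` V) - 1)" .
    then show ?thesis unfolding split A using False by (simp add: e del: map_map)
  qed
qed

lemma card_trees:
  assumes "finite V" "V \<noteq> {}" "distinct (map edge es)"
    and "\<forall>(u, v)\<in>set es. u \<in> V \<and> v \<in> V \<and> u \<noteq> v"
  shows "card {F. F \<subseteq> edge ` set es \<and> tree_on V F} = tree_count es (card V)"
proof -
  show ?thesis
    using card_tree_extensions[of V "{}" id es] assms
    by (simp add: map_prod.id forest_def is_cycle_def)
qed

definition avoiding :: "'v \<Rightarrow> ('v \<times> 'v) list \<Rightarrow> ('v \<times> 'v) list" where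
  "avoiding v = filter (\<lambda>e. v \<notin> edge e)"

text \<open>
  A leaf v is attached by exactly one edge e, so that the trees split according to e.
  Contracting e removes v from the graph, and the remaining count does not depend on the
  choice of e.
\<close>

lemma card_trees_with_leaf:
  assumes "finite V" "distinct (map edge es)" "v \<in> V"
    and es: "\<forall>(u, v)\<in>set es. u \<in> V \<and> v \<in> V \<and> u \<noteq> v"
  shows "card {F. F \<subseteq> edge ` set es \<and> tree_on V F \<and> card {e \<in> F. v \<in> e} = 1} =
           card {e \<in> edge ` set es. v \<in> e} * tree_count (avoiding v es) (card V - 1)"
proof -
  let ?E = "edge ` set es" and ?E' = "edge ` set (avoiding v es)"
  have E': "?E' = {e \<in> ?E. v \<notin> e}" by (auto simp: avoiding_def)
  define S where "S e = {F. F \<subseteq> ?E' \<and> tree_on V ({e} \<union> F)}" for e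
  have count: "card (S e) = tree_count (avoiding v es) (card V - 1)"
    if eE: "e \<in> ?E" and ve: "v \<in> e" for e
  proof -
    obtain a b where ab: "(a, b) \<in> set es" "e = {a, b}"
      using eE by (force simp: edge_def)
    moreover have "a \<in> V" "b \<in> V" "a \<noteq> b" using ab es by auto
    ultimately obtain w where w: "e = {v, w}" "w \<in> V" "w \<noteq> v"
      using ve by (cases "a = v") (auto simp: insert_commute)
    have "card (S e) = tree_count (relabel (sub v w) (avoiding v es)) (card (sub v w ` V))"
      unfolding S_def
    proof (rule card_tree_extensions)
      show "forest {e}" using forest_insert_iff[of v w "{}"] w
        by (auto simp: forest_def is_cycle_def)
      show "\<forall>e\<in>{e}. e \<subseteq> V \<and> card e = 2" using w assms by auto
      show "sub v w x = sub v w y \<longleftrightarrow> (x, y) \<in> conn {e}" for x y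
        using w by (auto simp: sub_def conn_insert_iff)
      show "distinct (map edge (avoiding v es))"
        using assms by (simp add: avoiding_def distinct_map_filter)
      show "{e} \<inter> ?E' = {}" using E' w by auto
    qed (use assms in \<open>auto simp: avoiding_def\<close>)
    moreover have "relabel (sub v w) (avoiding v es) = avoiding v es"
      by (rule map_idI) (auto simp: avoiding_def sub_def edge_def)
    moreover have "sub v w ` V = V - {v}" using w by (auto simp: sub_def)
    ultimately show ?thesis using assms by simp
  qed
  have "{F. F \<subseteq> ?E \<and> tree_on V F \<and> card {e \<in> F. v \<in> e} = 1} =
      (\<Union>e\<in>{e \<in> ?E. v \<in> e}. insert e ` S e)" (is "?L = ?R")
  proof (intro equalityI subsetI)
    fix F assume F: "F \<in> ?L"
    then obtain e where e: "{e \<in> F. v \<in> e} = {e}" by (auto simp: card_1_singleton_iff)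
    then have eF: "e \<in> F" "v \<in> e" by blast+
    have only: "f = e" if "f \<in> F" "v \<in> f" for f
      using e that by blast
    have F_eq: "insert e (F - {e}) = F" using eF by auto
    have "F - {e} \<subseteq> ?E'" using F only unfolding E' by blast
    then have "F - {e} \<in> S e" using F F_eq by (simp add: S_def)
    moreover have "e \<in> {e \<in> ?E. v \<in> e}" using eF F by blast
    ultimately show "F \<in> ?R" using F_eq by blast
  next
    fix F assume "F \<in> ?R"
    then obtain e G where e: "e \<in> ?E" "v \<in> e" "G \<in> S e" "F = insert e G" by auto
    then have "{e \<in> F. v \<in> e} = {e}" using E' by (auto simp: S_def)
    then show "F \<in> ?L" using e E' by (auto simp: S_def)
  qed
  moreover have notin: "e \<notin> F" if "F \<in> S e'" "v \<in> e" for e e' F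
  proof -
    have "F \<subseteq> ?E'" using that(1) by (simp add: S_def)
    then show ?thesis using that(2) unfolding E' by blast
  qed
  have "card ?R = (\<Sum>e\<in>{e \<in> ?E. v \<in> e}. card (insert e ` S e))"
  proof (rule card_UN_disjoint)
    have "S e \<subseteq> Pow ?E'" for e by (auto simp: S_def)
    then have "finite (S e)" for e by (rule finite_subset) simp
    then show "\<forall>e\<in>{e \<in> ?E. v \<in> e}. finite (insert e ` S e)" by simp
    show "\<forall>e\<in>{e \<in> ?E. v \<in> e}. \<forall>e'\<in>{e \<in> ?E. v \<in> e}. e \<noteq> e' \<longrightarrow>
        insert e ` S e \<inter> insert e' ` S e' = {}"
    proof (intro ballI impI equals0I)
      fix e e' F assume e: "e \<in> {e \<in> ?E. v \<in> e}" "e \<noteq> e'"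
        and F: "F \<in> insert e ` S e \<inter> insert e' ` S e'"
      then obtain G where G: "F = insert e' G" "G \<in> S e'" by auto
      then have "e \<in> insert e' G" using F by auto
      then show False using notin[OF G(2)] e by auto
    qed
  qed simp
  moreover have "card (insert e ` S e) = tree_count (avoiding v es) (card V - 1)"
    if "e \<in> ?E" "v \<in> e" for e
  proof -
    have "inj_on (insert e) (S e)"
      using notin[OF _ that(2)] by (auto intro!: inj_onI simp: insert_ident)
    then show ?thesis using count[OF that] by (simp add: card_image)
  qed
  ultimately show ?thesis by simp
qed

text \<open>
  Contraction lowers k by one and the number of labels by at least one, so the excess
  persists until no edge is left. Since a contraction needs two labels, k is at least three
  before it, and so at least two at the end.
\<close>

lemma tree_count_eq_0:
  assumes "card (fst ` set es \<union> snd ` set es) < k" "2 \<le> k"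
  shows "tree_count es k = 0"
  using assms
proof (induction es k rule: tree_count.induct)
  case (1 k)
  then show ?case by simp
next
  case (2 a b es k)
  let ?L = "\<lambda>es :: ('a \<times> 'a) list. fst ` set es \<union> snd ` set es"
  have L: "?L ((a, b) # es) = {a, b} \<union> ?L es" by auto
  have "card (?L es) \<le> card (?L ((a, b) # es))" unfolding L by (rule card_mono) auto
  then have 1: "tree_count es k = 0" using 2 by auto
  show ?case
  proof (cases "a = b")
    case True
    then show ?thesis using 1 by simp
  next
    case False
    have "{a, b} \<subseteq> ?L ((a, b) # es)" by auto
    then have "card {a, b} \<le> card (?L ((a, b) # es))" by (rule card_mono[rotated]) simp
    then have k: "2 \<le> k - 1" using False 2(3) by simp
    have "?L (relabel (sub a b) es) \<subseteq> ?L ((a, b) # es) - {a}"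
      using False by (force simp: sub_def split: if_splits)
    then have "card (?L (relabel (sub a b) es)) \<le> card (?L ((a, b) # es) - {a})"
      by (rule card_mono[rotated]) simp
    also have "\<dots> < k - 1" using 2(3) k by (subst card_Diff_singleton) auto
    finally show ?thesis using 1 2(2)[OF False] k False by simp
  qed
qed

section \<open>Graphs with an open column of two or three labels\<close>

text \<open>
  The edge list g x y z describes a graph whose inner vertices S have already been named,
  while the three vertices of its last column are still parameters. Gluing is done by passing
  equal labels: the five numbers are the spanning tree counts for distinct labels, for the
  first two, the last two and the outer two labels being equal, and for a single label. The
  condition on \<open>relabel\<close> expresses that contracting an edge at the open column only changes the
  three parameters.
\<close>

definition frontier3 :: "'v set \<Rightarrow> ('v \<Rightarrow> 'v \<Rightarrow> 'v \<Rightarrow> ('v \<times> 'v) list) \<Rightarrow>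
    real \<Rightarrow> real \<Rightarrow> real \<Rightarrow> real \<Rightarrow> real \<Rightarrow> bool" where
  "frontier3 S g a b\<^sub>1 b\<^sub>2 c d \<longleftrightarrow> finite S \<and>
     (\<forall>x y z. fst ` set (g x y z) \<union> snd ` set (g x y z) \<subseteq> S \<union> {x, y, z}) \<and>
     (\<forall>s x y z. (\<forall>t\<in>S. s t = t) \<longrightarrow> relabel s (g x y z) = g (s x) (s y) (s z)) \<and>
     (\<forall>x y z. x \<notin> S \<and> y \<notin> S \<and> z \<notin> S \<and> x \<noteq> y \<and> y \<noteq> z \<and> x \<noteq> z \<longrightarrow>
        real (tree_count (g x y z) (card S + 3)) = a) \<and>
     (\<forall>x y. x \<notin> S \<and> y \<notin> S \<and> x \<noteq> y \<longrightarrow>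
        real (tree_count (g x x y) (card S + 2)) = b\<^sub>1 \<and>
        real (tree_count (g x y y) (card S + 2)) = b\<^sub>2 \<and>
        real (tree_count (g x y x) (card S + 2)) = c) \<and>
     (\<forall>x. x \<notin> S \<longrightarrow> real (tree_count (g x x x) (card S + 1)) = d)"

definition frontier2 :: "'v set \<Rightarrow> ('v \<Rightarrow> 'v \<Rightarrow> ('v \<times> 'v) list) \<Rightarrow> real \<Rightarrow> real \<Rightarrow> bool" where
  "frontier2 S g a d \<longleftrightarrow> finite S \<and>
     (\<forall>x y. fst ` set (g x y) \<union> snd ` set (g x y) \<subseteq> S \<union> {x, y}) \<and>
     (\<forall>s x y. (\<forall>t\<in>S. s t = t) \<longrightarrow> relabel s (g x y) = g (s x) (s y)) \<and>
     (\<forall>x y. x \<notin> S \<and> y \<notin> S \<and> x \<noteq> y \<longrightarrow>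
        real (tree_count (g x y) (card S + 2)) = a) \<and>
     (\<forall>x. x \<notin> S \<longrightarrow> real (tree_count (g x x) (card S + 1)) = d)"

text \<open>
  The vertices that k counts beyond the labels available to g are isolated.
\<close>

lemma frontier3_tree_count_eq_0:
  assumes F: "frontier3 S g a b\<^sub>1 b\<^sub>2 c d" and k: "card S + card {p, q, r} < k"
  shows "tree_count (g p q r) k = 0"
proof (rule tree_count_eq_0)
  have fin: "finite S" using F by (simp add: frontier3_def)
  have "card (fst ` set (g p q r) \<union> snd ` set (g p q r)) \<le> card (S \<union> {p, q, r})"
    using F fin by (intro card_mono) (auto simp: frontier3_def)
  also have "\<dots> \<le> card S + card {p, q, r}" by (rule card_Un_le)
  finally show "card (fst ` set (g p q r) \<union> snd ` set (g p q r)) < k" using k by simp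
  have "card {p, q, r} \<ge> 1" by (simp add: Suc_le_eq card_gt_0_iff)
  then show "2 \<le> k" using k by simp
qed

lemma frontier3_tree_count:
  assumes F: "frontier3 S g a b\<^sub>1 b\<^sub>2 c d"
  shows "card S + 3 \<le> k \<Longrightarrow> x \<notin> S \<Longrightarrow> y \<notin> S \<Longrightarrow> z \<notin> S \<Longrightarrow> x \<noteq> y \<Longrightarrow> x \<noteq> z \<Longrightarrow> y \<noteq> z \<Longrightarrow>
      real (tree_count (g x y z) k) = (if k = card S + 3 then a else 0)"
    and "card S + 2 \<le> k \<Longrightarrow> x \<notin> S \<Longrightarrow> y \<notin> S \<Longrightarrow> x \<noteq> y \<Longrightarrow>
      real (tree_count (g x x y) k) = (if k = card S + 2 then b\<^sub>1 else 0)"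
    and "card S + 2 \<le> k \<Longrightarrow> x \<notin> S \<Longrightarrow> y \<notin> S \<Longrightarrow> x \<noteq> y \<Longrightarrow>
      real (tree_count (g x y y) k) = (if k = card S + 2 then b\<^sub>2 else 0)"
    and "card S + 2 \<le> k \<Longrightarrow> x \<notin> S \<Longrightarrow> y \<notin> S \<Longrightarrow> x \<noteq> y \<Longrightarrow>
      real (tree_count (g x y x) k) = (if k = card S + 2 then c else 0)"
    and "card S + 1 \<le> k \<Longrightarrow> x \<notin> S \<Longrightarrow>
      real (tree_count (g x x x) k) = (if k = card S + 1 then d else 0)"
  using F frontier3_tree_count_eq_0[OF F] by (auto simp: frontier3_def card_insert_if)

lemma frontier2_tree_count_eq_0:
  assumes F: "frontier2 S g a d" and k: "card S + card {p, q} < k"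
  shows "tree_count (g p q) k = 0"
proof (rule tree_count_eq_0)
  have fin: "finite S" using F by (simp add: frontier2_def)
  have "card (fst ` set (g p q) \<union> snd ` set (g p q)) \<le> card (S \<union> {p, q})"
    using F fin by (intro card_mono) (auto simp: frontier2_def)
  also have "\<dots> \<le> card S + card {p, q}" by (rule card_Un_le)
  finally show "card (fst ` set (g p q) \<union> snd ` set (g p q)) < k" using k by simp
  have "card {p, q} \<ge> 1" by (simp add: Suc_le_eq card_gt_0_iff)
  then show "2 \<le> k" using k by simp
qed

lemma frontier2_tree_count:
  assumes F: "frontier2 S g a d"
  shows "card S + 2 \<le> k \<Longrightarrow> x \<notin> S \<Longrightarrow> y \<notin> S \<Longrightarrow> x \<noteq> y \<Longrightarrow>
      real (tree_count (g x y) k) = (if k = card S + 2 then a else 0)"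
    and "card S + 1 \<le> k \<Longrightarrow> x \<notin> S \<Longrightarrow>
      real (tree_count (g x x) k) = (if k = card S + 1 then d else 0)"
  using F frontier2_tree_count_eq_0[OF F] by (auto simp: frontier2_def card_insert_if)

lemma sub_same: "sub a b a = b"
  by (simp add: sub_def)

lemma sub_other: "x \<noteq> a \<Longrightarrow> sub a b x = x"
  by (simp add: sub_def)

lemma frontier3D:
  assumes "frontier3 S g a b\<^sub>1 b\<^sub>2 c d"
  shows "finite S" "fst ` set (g x y z) \<union> snd ` set (g x y z) \<subseteq> S \<union> {x, y, z}"
    and "(\<And>t. t \<in> S \<Longrightarrow> s t = t) \<Longrightarrow> relabel s (g x y z) = g (s x) (s y) (s z)"
  using assms by (simp_all add: frontier3_def)

lemma frontier2D:
  assumes "frontier2 S g a d"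
  shows "finite S" "fst ` set (g x y) \<union> snd ` set (g x y) \<subseteq> S \<union> {x, y}"
    and "(\<And>t. t \<in> S \<Longrightarrow> s t = t) \<Longrightarrow> relabel s (g x y) = g (s x) (s y)"
  using assms by (simp_all add: frontier2_def)

lemma frontier3_relabel:
  assumes "frontier3 S g a b\<^sub>1 b\<^sub>2 c d" "p \<notin> S"
  shows "relabel (sub p q) (g x y z) = g (sub p q x) (sub p q y) (sub p q z)"
  by (rule frontier3D(3)[OF assms(1)]) (use assms(2) in \<open>auto simp: sub_def\<close>)

lemma frontier2_relabel:
  assumes "frontier2 S g a d" "p \<notin> S"
  shows "relabel (sub p q) (g x y) = g (sub p q x) (sub p q y)"
  by (rule frontier2D(3)[OF assms(1)]) (use assms(2) in \<open>auto simp: sub_def\<close>)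

lemma frontier3I:
  assumes "finite S"
    and "\<And>x y z. fst ` set (g x y z) \<union> snd ` set (g x y z) \<subseteq> S \<union> {x, y, z}"
    and "\<And>s x y z. (\<And>t. t \<in> S \<Longrightarrow> s t = t) \<Longrightarrow> relabel s (g x y z) = g (s x) (s y) (s z)"
    and "\<And>x y z. x \<notin> S \<Longrightarrow> y \<notin> S \<Longrightarrow> z \<notin> S \<Longrightarrow> x \<noteq> y \<Longrightarrow> y \<noteq> z \<Longrightarrow> x \<noteq> z \<Longrightarrow>
      real (tree_count (g x y z) (card S + 3)) = a"
    and "\<And>x y. x \<notin> S \<Longrightarrow> y \<notin> S \<Longrightarrow> x \<noteq> y \<Longrightarrow> real (tree_count (g x x y) (card S + 2)) = b\<^sub>1"
    and "\<And>x y. x \<notin> S \<Longrightarrow> y \<notin> S \<Longrightarrow> x \<noteq> y \<Longrightarrow> real (tree_count (g x y y) (card S + 2)) = b\<^sub>2"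
    and "\<And>x y. x \<notin> S \<Longrightarrow> y \<notin> S \<Longrightarrow> x \<noteq> y \<Longrightarrow> real (tree_count (g x y x) (card S + 2)) = c"
    and "\<And>x. x \<notin> S \<Longrightarrow> real (tree_count (g x x x) (card S + 1)) = d"
  shows "frontier3 S g a b\<^sub>1 b\<^sub>2 c d"
  unfolding frontier3_def using assms by simp

lemma frontier2I:
  assumes "finite S"
    and "\<And>x y. fst ` set (g x y) \<union> snd ` set (g x y) \<subseteq> S \<union> {x, y}"
    and "\<And>s x y. (\<And>t. t \<in> S \<Longrightarrow> s t = t) \<Longrightarrow> relabel s (g x y) = g (s x) (s y)"
    and "\<And>x y. x \<notin> S \<Longrightarrow> y \<notin> S \<Longrightarrow> x \<noteq> y \<Longrightarrow> real (tree_count (g x y) (card S + 2)) = a"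
    and "\<And>x. x \<notin> S \<Longrightarrow> real (tree_count (g x x) (card S + 1)) = d"
  shows "frontier2 S g a d"
  unfolding frontier2_def using assms by simp

text \<open>
  Deletion and contraction are now run over a few new edges at once. Each subset of them that
  closes no cycle and cuts off no old label contributes one of the numbers of g.
\<close>

lemma frontier3_verticals:
  assumes F: "frontier3 S g a b\<^sub>1 b\<^sub>2 c d"
  shows "frontier3 S (\<lambda>x y z. [(x, y), (y, z)] @ g x y z)
    (a + b\<^sub>1 + b\<^sub>2 + d) (b\<^sub>1 + d) (b\<^sub>2 + d) (c + 2 * d) d"
  by (rule frontier3I)
    (use frontier3D(1)[OF F] frontier3D(2)[OF F] in
      \<open>auto simp: frontier3D(3)[OF F] frontier3_relabel[OF F] frontier3_tree_count[OF F]
        frontier3_tree_count_eq_0[OF F] card_insert_if sub_same sub_other\<close>)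

lemma frontier3_horizontals:
  assumes F: "frontier3 S g a b\<^sub>1 b\<^sub>2 c d"
    and S: "A \<notin> S" "B \<notin> S" "C \<notin> S" "A \<noteq> B" "A \<noteq> C" "B \<noteq> C"
  shows "frontier3 (S \<union> {A, B, C}) (\<lambda>x y z. [(A, x), (B, y), (C, z)] @ g A B C)
    a (2 * a + b\<^sub>1) (2 * a + b\<^sub>2) (2 * a + c) (3 * a + b\<^sub>1 + b\<^sub>2 + c + d)"
  by (rule frontier3I)
    (use S frontier3D(1)[OF F] frontier3D(2)[OF F, of A B C] in
      \<open>auto simp: frontier3D(3)[OF F] frontier3_relabel[OF F] frontier3_tree_count[OF F]
        frontier3_tree_count_eq_0[OF F] card_insert_if sub_same sub_other\<close>)

lemma frontier2_vertical:
  assumes F: "frontier2 S g a d"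
  shows "frontier2 S (\<lambda>x y. [(x, y)] @ g x y)
    (a + d) d"
  by (rule frontier2I)
    (use frontier2D(1)[OF F] frontier2D(2)[OF F] in
      \<open>auto simp: frontier2D(3)[OF F] frontier2_relabel[OF F] frontier2_tree_count[OF F]
        frontier2_tree_count_eq_0[OF F] card_insert_if sub_same sub_other\<close>)

text \<open>
  Deleting a vertex of a column leaves a column of two vertices. The lemmas \<open>narrow_top\<close>,
  \<open>narrow_middle\<close> and \<open>narrow_bottom\<close> lead from a complete column to one without its first,
  second or third vertex, and the lemmas \<open>widen_top\<close>, \<open>widen_middle\<close> and \<open>widen_bottom\<close> lead back
  to a complete column. There the label in the row of the deleted vertex is isolated unless
  it is glued to another one, which gives the zeros.
\<close>

lemma narrow_top:
  assumes F: "frontier3 S g a b\<^sub>1 b\<^sub>2 c d"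
    and S: "A \<notin> S" "B \<notin> S" "C \<notin> S" "A \<noteq> B" "A \<noteq> C" "B \<noteq> C"
  shows "frontier2 (S \<union> {A, B, C}) (\<lambda>x y. [(B, x), (C, y)] @ g A B C)
    a (2 * a + b\<^sub>2)"
  by (rule frontier2I)
    (use S frontier3D(1)[OF F] frontier3D(2)[OF F, of A B C] in
      \<open>auto simp: frontier3D(3)[OF F] frontier3_relabel[OF F] frontier3_tree_count[OF F]
        frontier3_tree_count_eq_0[OF F] card_insert_if sub_same sub_other\<close>)

lemma narrow_middle:
  assumes F: "frontier3 S g a b\<^sub>1 b\<^sub>2 c d"
    and S: "A \<notin> S" "B \<notin> S" "C \<notin> S" "A \<noteq> B" "A \<noteq> C" "B \<noteq> C"
  shows "frontier2 (S \<union> {A, B, C}) (\<lambda>x y. [(A, x), (C, y)] @ g A B C)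
    a (2 * a + c)"
  by (rule frontier2I)
    (use S frontier3D(1)[OF F] frontier3D(2)[OF F, of A B C] in
      \<open>auto simp: frontier3D(3)[OF F] frontier3_relabel[OF F] frontier3_tree_count[OF F]
        frontier3_tree_count_eq_0[OF F] card_insert_if sub_same sub_other\<close>)

lemma narrow_bottom:
  assumes F: "frontier3 S g a b\<^sub>1 b\<^sub>2 c d"
    and S: "A \<notin> S" "B \<notin> S" "C \<notin> S" "A \<noteq> B" "A \<noteq> C" "B \<noteq> C"
  shows "frontier2 (S \<union> {A, B, C}) (\<lambda>x y. [(A, x), (B, y)] @ g A B C)
    a (2 * a + b\<^sub>1)"
  by (rule frontier2I)
    (use S frontier3D(1)[OF F] frontier3D(2)[OF F, of A B C] in
      \<open>auto simp: frontier3D(3)[OF F] frontier3_relabel[OF F] frontier3_tree_count[OF F]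
        frontier3_tree_count_eq_0[OF F] card_insert_if sub_same sub_other\<close>)

lemma widen_top:
  assumes F: "frontier2 S g a d"
    and S: "A \<notin> S" "B \<notin> S" "A \<noteq> B"
  shows "frontier3 (S \<union> {A, B}) (\<lambda>x y z. [(A, y), (B, z)] @ g A B)
    0 a 0 a (2 * a + d)"
  by (rule frontier3I)
    (use S frontier2D(1)[OF F] frontier2D(2)[OF F, of A B] in
      \<open>auto simp: frontier2D(3)[OF F] frontier2_relabel[OF F] frontier2_tree_count[OF F]
        frontier2_tree_count_eq_0[OF F] card_insert_if sub_same sub_other\<close>)

lemma widen_middle:
  assumes F: "frontier2 S g a d"
    and S: "A \<notin> S" "B \<notin> S" "A \<noteq> B"
  shows "frontier3 (S \<union> {A, B}) (\<lambda>x y z. [(A, x), (B, z)] @ g A B)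
    0 a a 0 (2 * a + d)"
  by (rule frontier3I)
    (use S frontier2D(1)[OF F] frontier2D(2)[OF F, of A B] in
      \<open>auto simp: frontier2D(3)[OF F] frontier2_relabel[OF F] frontier2_tree_count[OF F]
        frontier2_tree_count_eq_0[OF F] card_insert_if sub_same sub_other\<close>)

lemma widen_bottom:
  assumes F: "frontier2 S g a d"
    and S: "A \<notin> S" "B \<notin> S" "A \<noteq> B"
  shows "frontier3 (S \<union> {A, B}) (\<lambda>x y z. [(A, x), (B, y)] @ g A B)
    0 0 a a (2 * a + d)"
  by (rule frontier3I)
    (use S frontier2D(1)[OF F] frontier2D(2)[OF F, of A B] in
      \<open>auto simp: frontier2D(3)[OF F] frontier2_relabel[OF F] frontier2_tree_count[OF F]
        frontier2_tree_count_eq_0[OF F] card_insert_if sub_same sub_other\<close>)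

section \<open>Growth of recursive sequences and of their convolutions\<close>

text \<open>
  The Lucas sequence \<open>U\<^sub>n(t, 1)\<close>; if \<open>t = r + 1 / r\<close>, then r and 1 / r are the roots of its
  characteristic polynomial.
\<close>

fun lucas_seq :: "real \<Rightarrow> nat \<Rightarrow> real" where
  "lucas_seq t 0 = 0"
| "lucas_seq t (Suc 0) = 1"
| "lucas_seq t (Suc (Suc n)) = t * lucas_seq t (Suc n) - lucas_seq t n"

lemma diff_inverse_nonzero:
  assumes "(r :: real) > 1"
  shows "r - 1 / r \<noteq> 0"
proof -
  have "1 / r < 1" using assms by simp
  then show ?thesis using assms by linarith
qed

lemma lucas_seq_closed_form:
  assumes "r > 1"
  shows "lucas_seq (r + 1 / r) n = (r ^ n - (1 / r) ^ n) / (r - 1 / r)"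
proof -
  note r = diff_inverse_nonzero[OF assms]
  show ?thesis
  proof (induction n rule: induct_nat_012)
    case (ge2 n)
    have "r * (1 / r) ^ Suc n = (1 / r) ^ n" "(1 / r) * r ^ Suc n = r ^ n"
      using assms by simp_all
    then have "(r + 1 / r) * (r ^ Suc n - (1 / r) ^ Suc n) - (r ^ n - (1 / r) ^ n) =
        r ^ Suc (Suc n) - (1 / r) ^ Suc (Suc n)"
      by (simp only: ring_distribs power_Suc)
    moreover have "lucas_seq (r + 1 / r) (Suc (Suc n)) =
        ((r + 1 / r) * (r ^ Suc n - (1 / r) ^ Suc n) - (r ^ n - (1 / r) ^ n)) / (r - 1 / r)"
      unfolding lucas_seq.simps ge2
      by (simp only: diff_divide_distrib[symmetric] times_divide_eq_right)
    ultimately show ?case by (simp only:)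
  qed (use r in auto)
qed

text \<open>
  In the closed form the power of 1 / r is negligible.
\<close>

lemma lucas_seq_asymp:
  assumes "r > 1"
  shows "(\<lambda>n. lucas_seq (r + 1 / r) n / r ^ n) \<longlonglongrightarrow> 1 / (r - 1 / r)"
    and "(\<lambda>n. lucas_seq (r + 1 / r) (Suc n) / r ^ n) \<longlonglongrightarrow> r / (r - 1 / r)"
proof -
  have "1 < r ^ 2" using assms by (simp add: one_less_power)
  moreover have "0 < r ^ 2" using assms by simp
  ultimately have "\<bar>1 / r ^ 2\<bar> < 1"
    by (simp only: abs_divide abs_one abs_power2 divide_less_eq_1_pos)
  then have 0: "(\<lambda>n. (1 / r ^ 2) ^ n) \<longlonglongrightarrow> 0" by (intro LIMSEQ_power_zero) simp
  have "(\<lambda>n. (1 - (1 / r ^ 2) ^ n) / (r - 1 / r)) \<longlonglongrightarrow> (1 - 0) / (r - 1 / r)"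
    by (rule tendsto_divide[OF tendsto_diff[OF tendsto_const 0] tendsto_const
          diff_inverse_nonzero[OF assms]])
  moreover have "lucas_seq (r + 1 / r) n / r ^ n = (1 - (1 / r ^ 2) ^ n) / (r - 1 / r)" for n
  proof -
    have "(r ^ n - (1 / r) ^ n) / r ^ n = 1 - (1 / r ^ 2) ^ n"
      using assms by (simp add: diff_divide_distrib power_divide power_mult_distrib power2_eq_square)
    moreover have "lucas_seq (r + 1 / r) n / r ^ n = (r ^ n - (1 / r) ^ n) / r ^ n / (r - 1 / r)"
      unfolding lucas_seq_closed_form[OF assms] by simp
    ultimately show ?thesis by simp
  qed
  ultimately show *: "(\<lambda>n. lucas_seq (r + 1 / r) n / r ^ n) \<longlonglongrightarrow> 1 / (r - 1 / r)" by simp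
  have "(\<lambda>n. r * (lucas_seq (r + 1 / r) (Suc n) / r ^ Suc n)) \<longlonglongrightarrow> r * (1 / (r - 1 / r))"
    by (rule tendsto_mult[OF tendsto_const LIMSEQ_Suc[OF *]])
  then show "(\<lambda>n. lucas_seq (r + 1 / r) (Suc n) / r ^ n) \<longlonglongrightarrow> r / (r - 1 / r)"
    using assms by simp
qed

lemma cesaro_mean_zero:
  fixes x :: "nat \<Rightarrow> real"
  assumes "x \<longlonglongrightarrow> 0"
  shows "(\<lambda>n. (\<Sum>i<n. x i) / real n) \<longlonglongrightarrow> 0"
proof (rule LIMSEQ_I)
  fix e :: real assume e: "e > 0"
  obtain N where N: "\<And>n. n \<ge> N \<Longrightarrow> \<bar>x n\<bar> < e / 2"
    using LIMSEQ_D[OF assms, of "e / 2"] e by auto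
  define K where "K = (\<Sum>i<N. \<bar>x i\<bar>)"
  obtain M :: nat where M: "real M > 2 * K / e" using reals_Archimedean2 by blast
  show "\<exists>no. \<forall>n\<ge>no. norm ((\<Sum>i<n. x i) / real n - 0) < e"
  proof (intro exI allI impI)
    fix n assume n: "n \<ge> Suc (max N M)"
    have "\<bar>\<Sum>i<n. x i\<bar> \<le> (\<Sum>i<n. \<bar>x i\<bar>)" by (rule sum_abs)
    also have "\<dots> = K + (\<Sum>i=N..<n. \<bar>x i\<bar>)"
    proof -
      have "{..<n} = {..<N} \<union> {N..<n}" using n by auto
      then show ?thesis unfolding K_def by (simp add: sum.union_disjoint ivl_disj_int)
    qed
    also have "(\<Sum>i=N..<n. \<bar>x i\<bar>) \<le> (\<Sum>i=N..<n. e / 2)"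
      by (rule sum_mono) (use N in \<open>auto intro: less_imp_le\<close>)
    also have "\<dots> \<le> n * (e / 2)" using n e by (simp add: mult_right_mono)
    also have "K < n * (e / 2)"
    proof -
      have "2 * K / e < n" using M n by linarith
      then show ?thesis using e by (simp add: field_simps)
    qed
    finally have "\<bar>\<Sum>i<n. x i\<bar> < n * e" by (simp add: field_simps)
    then show "norm ((\<Sum>i<n. x i) / real n - 0) < e"
      using n by (simp add: field_simps)
  qed
qed

text \<open>
  The error of a summand is at most \<open>B * \<bar>x i - a\<bar> + \<bar>a\<bar> * \<bar>y (n - Suc i) - b\<bar>\<close>, where B bounds
  y. After reversing the order of the second part, both errors are averages of null
  sequences.
\<close>

lemma convolution_mean_tendsto:
  fixes x y :: "nat \<Rightarrow> real"
  assumes x: "x \<longlonglongrightarrow> a" and y: "y \<longlonglongrightarrow> b"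
  shows "(\<lambda>n. (\<Sum>i<n. y (n - Suc i) * x i) / real n) \<longlonglongrightarrow> b * a"
proof -
  have "Bseq y" using y by (simp add: convergent_imp_Bseq convergentI)
  then obtain B where B: "\<And>n. \<bar>y n\<bar> \<le> B" by (auto simp: Bseq_def)
  let ?u = "\<lambda>n. (\<Sum>i<n. B * \<bar>x i - a\<bar> + \<bar>a\<bar> * \<bar>y i - b\<bar>) / real n"
  have "(\<lambda>i. B * \<bar>x i - a\<bar> + \<bar>a\<bar> * \<bar>y i - b\<bar>) \<longlonglongrightarrow> B * \<bar>a - a\<bar> + \<bar>a\<bar> * \<bar>b - b\<bar>"
    by (intro tendsto_intros x y)
  then have u: "?u \<longlonglongrightarrow> 0" by (intro cesaro_mean_zero) simp
  have "\<forall>\<^sub>F n in sequentially. norm ((\<Sum>i<n. y (n - Suc i) * x i) / real n - b * a) \<le> ?u n"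
  proof (rule eventually_sequentiallyI)
    fix n :: nat assume n: "n \<ge> 1"
    have "(\<Sum>i<n. y (n - Suc i) * x i) / n - b * a = (\<Sum>i<n. y (n - Suc i) * x i - b * a) / n"
      using n by (simp add: sum_subtractf field_simps)
    also have "\<bar>\<dots>\<bar> \<le> (\<Sum>i<n. \<bar>y (n - Suc i) * x i - b * a\<bar>) / n"
      by (simp add: divide_right_mono)
    also have "(\<Sum>i<n. \<bar>y (n - Suc i) * x i - b * a\<bar>) \<le>
        (\<Sum>i<n. B * \<bar>x i - a\<bar> + \<bar>a\<bar> * \<bar>y (n - Suc i) - b\<bar>)"
    proof (rule sum_mono)
      fix i
      have "y (n - Suc i) * x i - b * a = y (n - Suc i) * (x i - a) + a * (y (n - Suc i) - b)"
        by (simp add: algebra_simps)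
      also have "\<bar>\<dots>\<bar> \<le> \<bar>y (n - Suc i) * (x i - a)\<bar> + \<bar>a * (y (n - Suc i) - b)\<bar>"
        by (rule abs_triangle_ineq)
      also have "\<dots> \<le> B * \<bar>x i - a\<bar> + \<bar>a\<bar> * \<bar>y (n - Suc i) - b\<bar>"
        unfolding abs_mult by (intro add_mono mult_right_mono B) auto
      finally show "\<bar>y (n - Suc i) * x i - b * a\<bar> \<le> B * \<bar>x i - a\<bar> + \<bar>a\<bar> * \<bar>y (n - Suc i) - b\<bar>" .
    qed
    also have "\<dots> = (\<Sum>i<n. B * \<bar>x i - a\<bar> + \<bar>a\<bar> * \<bar>y i - b\<bar>)"
      by (simp add: sum.distrib sum.nat_diff_reindex[of "\<lambda>i. \<bar>a\<bar> * \<bar>y i - b\<bar>" n])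
    finally show "norm ((\<Sum>i<n. y (n - Suc i) * x i) / real n - b * a) \<le> ?u n"
      using n by (simp add: divide_right_mono)
  qed
  then have "(\<lambda>n. (\<Sum>i<n. y (n - Suc i) * x i) / real n - b * a) \<longlonglongrightarrow> 0"
  proof (intro tendsto_0_le[OF u, of _ 1], eventually_elim)
    case (elim n)
    moreover have "?u n \<le> norm (?u n)" by (simp only: real_norm_def abs_ge_self)
    ultimately show ?case by linarith
  qed
  then show ?thesis by (simp add: LIM_zero_iff)
qed

lemma power_weighted_convolution_tendsto:
  fixes x y :: "nat \<Rightarrow> real"
  assumes "r > 0" and x: "(\<lambda>i. x i / r ^ i) \<longlonglongrightarrow> a" and y: "(\<lambda>i. y i / r ^ i) \<longlonglongrightarrow> b"
  shows "(\<lambda>n. (\<Sum>i<Suc n. y (n - i) * x i) / (real (Suc n) * r ^ n)) \<longlonglongrightarrow> b * a"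
proof -
  have "(\<Sum>i<Suc n. y (Suc n - Suc i) / r ^ (Suc n - Suc i) * (x i / r ^ i)) / real (Suc n) =
      (\<Sum>i<Suc n. y (n - i) * x i) / (real (Suc n) * r ^ n)" for n
  proof -
    have "y (Suc n - Suc i) / r ^ (Suc n - Suc i) * (x i / r ^ i) = y (n - i) * x i / r ^ n"
      if "i < Suc n" for i
    proof -
      have "r ^ n = r ^ (n - i) * r ^ i" using that by (simp flip: power_add)
      then show ?thesis by simp
    qed
    then have "(\<Sum>i<Suc n. y (Suc n - Suc i) / r ^ (Suc n - Suc i) * (x i / r ^ i)) =
        (\<Sum>i<Suc n. y (n - i) * x i / r ^ n)"
      by (intro sum.cong) auto
    then show ?thesis
      by (simp only: sum_divide_distrib[symmetric] divide_divide_eq_left mult.commute)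
  qed
  with LIMSEQ_Suc[OF convolution_mean_tendsto[OF x y]] show ?thesis by (simp only:)
qed

section \<open>Leaves of spanning trees\<close>

lemma spanning_trees_eq_image:
  "spanning_trees G =
     (\<lambda>F. \<lparr>verts = verts G, edges = F\<rparr>) ` {F. F \<subseteq> edges G \<and> tree_on (verts G) F}"
proof (intro equalityI subsetI)
  fix T assume T: "T \<in> spanning_trees G"
  moreover obtain V F where "T = \<lparr>verts = V, edges = F\<rparr>" by (cases T) auto
  ultimately show "T \<in> (\<lambda>F. \<lparr>verts = verts G, edges = F\<rparr>) ` {F. F \<subseteq> edges G \<and> tree_on (verts G) F}"
    by (auto simp: spanning_trees_def)
qed (auto simp: spanning_trees_def)

lemma inj_on_spanning_subgraph: "inj_on (\<lambda>F. \<lparr>verts = V, edges = F\<rparr>) A"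
  by (rule inj_onI) simp

lemma num_spanning_trees_eq:
  "num_spanning_trees G = card {F. F \<subseteq> edges G \<and> tree_on (verts G) F}"
  unfolding num_spanning_trees_def spanning_trees_eq_image
  by (rule card_image[OF inj_on_spanning_subgraph])

lemma card_filter_eq_sum:
  "finite A \<Longrightarrow> card {x \<in> A. P x} = (\<Sum>x\<in>A. if P x then 1 else 0)"
  by (subst sum.inter_filter[symmetric]) simp_all

definition leaf_trees :: "'v ugraph \<Rightarrow> 'v \<Rightarrow> 'v set set set" where
  "leaf_trees G v = {F. F \<subseteq> edges G \<and> tree_on (verts G) F \<and> card {e \<in> F. v \<in> e} = 1}"

lemma finite_subgraphs: "simple_graph G \<Longrightarrow> finite {F. F \<subseteq> edges G \<and> P F}"
proof -
  assume "simple_graph G"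
  then have "edges G \<subseteq> Pow (verts G)" "finite (verts G)" by (auto simp: simple_graph_def)
  then have "finite (edges G)" by (meson finite_Pow_iff finite_subset)
  then show ?thesis by (auto intro: rev_finite_subset[of "Pow (edges G)"])
qed

lemma sum_card_leaves:
  assumes "simple_graph G"
  shows "(\<Sum>T\<in>spanning_trees G. card (leaves T)) = (\<Sum>v\<in>verts G. card (leaf_trees G v))"
proof -
  let ?S = "{F. F \<subseteq> edges G \<and> tree_on (verts G) F}"
  have fin: "finite ?S" "finite (verts G)"
    using assms by (auto simp: finite_subgraphs simple_graph_def)
  have "(\<Sum>T\<in>spanning_trees G. card (leaves T)) =
      (\<Sum>F\<in>?S. card {v \<in> verts G. card {e \<in> F. v \<in> e} = 1})"
    unfolding spanning_trees_eq_image sum.reindex[OF inj_on_spanning_subgraph] o_def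
    by (simp add: leaves_def degree_def)
  also have "\<dots> = (\<Sum>F\<in>?S. \<Sum>v\<in>verts G. if card {e \<in> F. v \<in> e} = 1 then 1 else 0)"
    unfolding card_filter_eq_sum[OF fin(2)] by (rule refl)
  also have "\<dots> = (\<Sum>v\<in>verts G. \<Sum>F\<in>?S. if card {e \<in> F. v \<in> e} = 1 then 1 else 0)"
    by (rule sum.swap)
  also have "\<dots> = (\<Sum>v\<in>verts G. card {F \<in> ?S. card {e \<in> F. v \<in> e} = 1})"
    unfolding card_filter_eq_sum[OF fin(1)] by (rule refl)
  also have "\<dots> = (\<Sum>v\<in>verts G. card (leaf_trees G v))"
    unfolding leaf_trees_def by (simp add: conj_ac)
  finally show ?thesis .
qed

lemma card_leaf_trees_le: "simple_graph G \<Longrightarrow> card (leaf_trees G v) \<le> num_spanning_trees G"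
  unfolding num_spanning_trees_eq leaf_trees_def
  by (rule card_mono) (auto simp: finite_subgraphs)

section \<open>The grid, column by column\<close>

type_synonym cell = "nat \<times> nat"
type_synonym open_graph = "cell \<Rightarrow> cell \<Rightarrow> cell \<Rightarrow> (cell \<times> cell) list"

text \<open>
  Here j is the column of the vertices that are open in g. They receive their names, and x,
  y, z take over as the open column.
\<close>

definition add_column :: "nat \<Rightarrow> open_graph \<Rightarrow> open_graph" where
  "add_column j g = (\<lambda>x y z. [(x, y), (y, z)] @ [((1, j), x), ((2, j), y), ((3, j), z)] @
     g (1, j) (2, j) (3, j))"

fun add_columns :: "nat \<Rightarrow> open_graph \<Rightarrow> nat \<Rightarrow> open_graph" where
  "add_columns j g 0 = g"
| "add_columns j g (Suc m) = add_column (j + m) (add_columns j g m)"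

text \<open>
  The first i + 1 columns, of which the last is open.
\<close>

definition strip :: "nat \<Rightarrow> open_graph" where
  "strip = add_columns 1 (\<lambda>x y z. [(x, y), (y, z)])"

definition grid_list :: "nat \<Rightarrow> (cell \<times> cell) list" where
  "grid_list i = strip i (1, Suc i) (2, Suc i) (3, Suc i)"

lemma strip_0: "strip 0 x y z = [(x, y), (y, z)]"
  by (simp add: strip_def)

lemma strip_Suc: "strip (Suc i) = add_column (Suc i) (strip i)"
  by (simp add: strip_def)

lemma strip_add: "strip (k + m) = add_columns (Suc k) (strip k) m"
  by (induction m) (simp_all add: strip_Suc)

lemma atLeastAtMost_1_3: "{1..3 :: nat} = {1, 2, 3}"
  by auto

lemma grid_edgeI:
  "u \<in> {1..a} \<times> {1..b} \<Longrightarrow> v \<in> {1..a} \<times> {1..b} \<Longrightarrow> grid_adj u v \<Longrightarrow> {u, v} \<in> edges (grid a b)"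
  unfolding grid_def by (simp only: ugraph.simps mem_Collect_eq) blast

lemma grid_edgeE:
  assumes "e \<in> edges (grid a b)"
  obtains u v where "e = {u, v}" "u \<in> {1..a} \<times> {1..b}" "v \<in> {1..a} \<times> {1..b}" "grid_adj u v"
  using assms unfolding grid_def by (simp only: ugraph.simps mem_Collect_eq) blast

lemma grid_edges_1: "edges (grid 3 1) = {{(1, 1), (2, 1)}, {(2, 1), (3, 1)}}"
proof (intro equalityI subsetI)
  show "e \<in> edges (grid 3 1) \<Longrightarrow> e \<in> {{(1, 1), (2, 1)}, {(2, 1), (3, 1)}}" for e
    unfolding grid_def atLeastAtMost_1_3 by (auto simp: grid_adj_def insert_commute)
  show "e \<in> {{(1, 1), (2, 1)}, {(2, 1), (3, 1)}} \<Longrightarrow> e \<in> edges (grid 3 1)" for e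
    by (auto intro!: grid_edgeI simp: grid_adj_def)
qed

text \<open>
  An edge that is not in the first n columns has an end in column n + 1, so it is one of the
  two edges of this column or one of the three edges to the column before.
\<close>

lemma grid_edges_Suc:
  assumes "n \<ge> 1"
  shows "edges (grid 3 (Suc n)) = edges (grid 3 n) \<union>
    {{(1, Suc n), (2, Suc n)}, {(2, Suc n), (3, Suc n)},
     {(1, n), (1, Suc n)}, {(2, n), (2, Suc n)}, {(3, n), (3, Suc n)}}" (is "?L = ?R")
proof (intro equalityI subsetI)
  fix e assume "e \<in> ?L"
  then obtain u v where e: "e = {u, v}" "u \<in> {1..3} \<times> {1..Suc n}" "v \<in> {1..3} \<times> {1..Suc n}"
    "grid_adj u v" by (rule grid_edgeE)
  show "e \<in> ?R"
  proof (cases "snd u \<le> n \<and> snd v \<le> n")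
    case True
    then have "u \<in> {1..3} \<times> {1..n}" "v \<in> {1..3} \<times> {1..n}"
      using True e(2,3) by (auto simp: mem_Times_iff)
    then show ?thesis using grid_edgeI[OF _ _ e(4)] e(1) by simp
  next
    case False
    obtain a b c d where uv: "u = (a, b)" "v = (c, d)" by (metis surj_pair)
    have rows: "a = 1 \<or> a = 2 \<or> a = 3" "c = 1 \<or> c = 2 \<or> c = 3" and cols: "b \<le> Suc n" "d \<le> Suc n"
      using e(2,3) unfolding uv by auto
    have last: "b = Suc n \<or> d = Suc n" using False cols unfolding uv by auto
    have "c = Suc a \<and> b = d \<or> a = Suc c \<and> b = d \<or> a = c \<and> d = Suc b \<or> a = c \<and> b = Suc d"
      using e(4) unfolding uv grid_adj_def fst_conv snd_conv by linarith
    then show ?thesis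
    proof (elim disjE conjE)
      assume "c = Suc a" "b = d"
      moreover from this have "a = 1 \<or> a = 2" "d = Suc n" using rows last by auto
      ultimately show ?thesis unfolding e(1) uv
        by (elim disjE) (simp_all add: numeral_2_eq_2 numeral_3_eq_3)
    next
      assume "a = Suc c" "b = d"
      moreover from this have "c = 1 \<or> c = 2" "d = Suc n" using rows last by auto
      ultimately show ?thesis unfolding e(1) uv
        by (elim disjE) (simp_all add: numeral_2_eq_2 numeral_3_eq_3 insert_commute)
    next
      assume "a = c" "d = Suc b"
      moreover from this have "b = n" using cols last by auto
      ultimately show ?thesis using rows(1) unfolding e(1) uv by (elim disjE) simp_all
    next
      assume "a = c" "b = Suc d"
      moreover from this have "d = n" using cols last by auto
      ultimately show ?thesis using rows(1) unfolding e(1) uv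
        by (elim disjE) (simp_all add: insert_commute)
    qed
  qed
next
  fix e assume "e \<in> ?R"
  moreover have "edges (grid 3 n) \<subseteq> ?L"
  proof
    fix e assume "e \<in> edges (grid 3 n)"
    then show "e \<in> ?L"
      by (rule grid_edgeE) (auto intro!: grid_edgeI simp: mem_Times_iff)
  qed
  ultimately show "e \<in> ?L" using assms
    by (auto intro!: grid_edgeI simp: grid_adj_def)
qed

lemma grid_edge_column_le: "e \<in> edges (grid 3 n) \<Longrightarrow> (a, Suc n) \<notin> e"
  by (auto elim!: grid_edgeE)

lemma grid_list_Suc: "grid_list (Suc i) =
  [((1, Suc (Suc i)), (2, Suc (Suc i))), ((2, Suc (Suc i)), (3, Suc (Suc i))),
   ((1, Suc i), (1, Suc (Suc i))), ((2, Suc i), (2, Suc (Suc i))), ((3, Suc i), (3, Suc (Suc i)))] @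
  grid_list i"
  by (simp add: grid_list_def strip_Suc add_column_def)

lemma edge_Pair: "edge (u, v) = {u, v}"
  by (simp add: edge_def)

lemma grid_list_correct:
  "edge ` set (grid_list i) = edges (grid 3 (Suc i)) \<and> distinct (map edge (grid_list i))"
proof (induction i)
  case 0
  have "edges (grid 3 (Suc 0)) = {{(1, 1), (2, 1)}, {(2, 1), (3, 1)}}" using grid_edges_1 by simp
  then show ?case by (auto simp: grid_list_def strip_0 edge_Pair doubleton_eq_iff)
next
  case (Suc i)
  have new: "{u, (a, Suc (Suc i))} \<notin> edges (grid 3 (Suc i))" for u a
    using grid_edge_column_le[of "{u, (a, Suc (Suc i))}" "Suc i" a] by auto
  have "edge ` set (grid_list (Suc i)) = edges (grid 3 (Suc (Suc i)))"
    unfolding grid_list_Suc using Suc grid_edges_Suc[of "Suc i"] by (auto simp: edge_Pair)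
  moreover have "distinct (map edge (grid_list (Suc i)))"
    unfolding grid_list_Suc using Suc new by (simp add: edge_Pair doubleton_eq_iff)
  ultimately show ?case by simp
qed

lemma grid_list_endpoints:
  "\<forall>(u, v)\<in>set (grid_list i). u \<in> verts (grid 3 (Suc i)) \<and> v \<in> verts (grid 3 (Suc i)) \<and> u \<noteq> v"
proof (induction i)
  case 0
  then show ?case by (auto simp: grid_list_def strip_0 grid_def)
next
  case (Suc i)
  have "verts (grid 3 (Suc i)) \<subseteq> verts (grid 3 (Suc (Suc i)))" by (auto simp: grid_def)
  then show ?case unfolding grid_list_Suc using Suc by (fastforce simp: grid_def)
qed

lemma num_spanning_trees_grid:
  "num_spanning_trees (grid 3 (Suc i)) = tree_count (grid_list i) (3 * Suc i)"
proof -
  have "card {F. F \<subseteq> edge ` set (grid_list i) \<and> tree_on (verts (grid 3 (Suc i))) F} =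
      tree_count (grid_list i) (card (verts (grid 3 (Suc i))))"
  proof (rule card_trees)
    show "finite (verts (grid 3 (Suc i)))" "verts (grid 3 (Suc i)) \<noteq> {}" by (auto simp: grid_def)
  qed (use grid_list_correct grid_list_endpoints in blast)+
  then show ?thesis
    using grid_list_correct[of i] by (simp add: num_spanning_trees_eq card_verts_grid)
qed

lemma card_leaf_trees_grid:
  assumes "v \<in> verts (grid 3 (Suc i))"
  shows "card (leaf_trees (grid 3 (Suc i)) v) =
    degree (grid 3 (Suc i)) v * tree_count (avoiding v (grid_list i)) (3 * Suc i - 1)"
proof -
  have "card {F. F \<subseteq> edge ` set (grid_list i) \<and> tree_on (verts (grid 3 (Suc i))) F \<and>
        card {e \<in> F. v \<in> e} = 1} =
      card {e \<in> edge ` set (grid_list i). v \<in> e} *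
        tree_count (avoiding v (grid_list i)) (card (verts (grid 3 (Suc i))) - 1)"
  proof (rule card_trees_with_leaf)
    show "finite (verts (grid 3 (Suc i)))" by (auto simp: grid_def)
  qed (use grid_list_correct grid_list_endpoints assms in blast)+
  then show ?thesis
    using grid_list_correct[of i] by (simp add: leaf_trees_def degree_def card_verts_grid)
qed

section \<open>Transfer across complete columns\<close>

text \<open>
  The inner vertices of \<open>strip i\<close>.
\<close>

definition first_columns :: "nat \<Rightarrow> cell set" where
  "first_columns i = {1..3} \<times> {1..i}"

lemma column_notin:
  assumes "S \<inter> {v. j \<le> snd v} = {}" "j \<le> k"
  shows "(a, k) \<notin> S"
  using assms by auto

text \<open>
  The composition of \<open>frontier3_horizontals\<close> and \<open>frontier3_verticals\<close>: the transfer matrix of a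
  column.
\<close>

lemma frontier3_add_column:
  assumes F: "frontier3 S g a b\<^sub>1 b\<^sub>2 c d" and S: "S \<inter> {v. j \<le> snd v} = {}"
  shows "frontier3 (S \<union> {(1, j), (2, j), (3, j)}) (add_column j g)
    (8 * a + 2 * b\<^sub>1 + 2 * b\<^sub>2 + c + d) (5 * a + 2 * b\<^sub>1 + b\<^sub>2 + c + d)
    (5 * a + b\<^sub>1 + 2 * b\<^sub>2 + c + d)
    (8 * a + 2 * b\<^sub>1 + 2 * b\<^sub>2 + 3 * c + 2 * d)
    (3 * a + b\<^sub>1 + b\<^sub>2 + c + d)"
proof -
  have "(1, j) \<notin> S" "(2, j) \<notin> S" "(3, j) \<notin> S" using column_notin[OF S] by auto
  from frontier3_verticals[OF frontier3_horizontals[OF F this]]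
  show ?thesis by (simp add: add_column_def algebra_simps)
qed

text \<open>
  The five numbers of \<open>strip i\<close> in closed form; by the reflection of the grid, gluing the first
  two or the last two vertices gives the same count.
\<close>

definition count_free :: "nat \<Rightarrow> real" where
  "count_free i = lucas_seq 3 (Suc i) * lucas_seq 5 (Suc i)"

definition count_adjacent :: "nat \<Rightarrow> real" where
  "count_adjacent i = lucas_seq 3 (Suc i) * lucas_seq 5 (Suc i) -
     (lucas_seq 3 (Suc i) * lucas_seq 5 i + lucas_seq 3 i * lucas_seq 5 (Suc i)) / 2"

definition count_outer :: "nat \<Rightarrow> real" where
  "count_outer i = 2 * lucas_seq 5 (Suc i) * (lucas_seq 3 (Suc i) - lucas_seq 3 i)"

definition count_all :: "nat \<Rightarrow> real" where
  "count_all i = (lucas_seq 3 (Suc i) - lucas_seq 3 i) * (lucas_seq 5 (Suc i) - lucas_seq 5 i)"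

text \<open>
  The weights, together with \<open>count_all\<close>, are the first row of the m-th power of the transfer
  matrix. Its first entry is \<open>count_all m\<close> because starting from the numbers 1, 0, 0, 0, 0
  amounts to gluing the vertices of the first column, the mirror image of gluing those of the
  last one.
\<close>

definition weight_adjacent :: "nat \<Rightarrow> real" where
  "weight_adjacent m = (lucas_seq 3 (Suc m) - lucas_seq 3 m) * lucas_seq 5 m"

definition weight_outer :: "nat \<Rightarrow> real" where
  "weight_outer m = (lucas_seq 3 m * lucas_seq 5 (Suc m) - lucas_seq 3 (Suc m) * lucas_seq 5 m) / 2"

definition weight_all :: "nat \<Rightarrow> real" where
  "weight_all m = lucas_seq 3 m * lucas_seq 5 m"

definition readout :: "nat \<Rightarrow> real \<Rightarrow> real \<Rightarrow> real \<Rightarrow> real \<Rightarrow> real \<Rightarrow> real" where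
  "readout m a b\<^sub>1 b\<^sub>2 c d = count_all m * a + weight_adjacent m * (b\<^sub>1 + b\<^sub>2) +
     weight_outer m * c + weight_all m * d"

lemmas readout_defs = readout_def count_all_def weight_adjacent_def weight_outer_def weight_all_def

lemma readout_0: "readout 0 a b\<^sub>1 b\<^sub>2 c d = a"
  by (simp add: readout_defs)

lemma readout_Suc:
  "readout m (8 * a + 2 * b\<^sub>1 + 2 * b\<^sub>2 + c + d) (5 * a + 2 * b\<^sub>1 + b\<^sub>2 + c + d)
    (5 * a + b\<^sub>1 + 2 * b\<^sub>2 + c + d)
    (8 * a + 2 * b\<^sub>1 + 2 * b\<^sub>2 + 3 * c + 2 * d)
    (3 * a + b\<^sub>1 + b\<^sub>2 + c + d) = readout (Suc m) a b\<^sub>1 b\<^sub>2 c d"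
  unfolding readout_defs lucas_seq.simps by (simp add: field_simps)

lemma add_columns_Suc_left:
  "add_columns j g (Suc m) = add_columns (Suc j) (add_column j g) m"
  by (induction m) simp_all

text \<open>
  After m further columns only the number for distinct labels matters. Instead of powers of
  the matrix it suffices to follow this linear functional backwards through the columns.
\<close>

lemma tree_count_add_columns:
  assumes "frontier3 S g a b\<^sub>1 b\<^sub>2 c d" and "S \<inter> {v. j \<le> snd v} = {}"
  shows "real (tree_count (add_columns j g m (1, j + m) (2, j + m) (3, j + m))
      (card S + 3 * m + 3)) = readout m a b\<^sub>1 b\<^sub>2 c d"
  using assms
proof (induction m arbitrary: j S g a b\<^sub>1 b\<^sub>2 c d)
  case 0
  then show ?case
    using frontier3_tree_count(1)[OF 0(1),
        where x = "(1, j)" and y = "(2, j)" and z = "(3, j)" and k = "card S + 3"]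
      column_notin[OF 0(2) order.refl] by (simp add: readout_0)
next
  case (Suc m)
  let ?S = "S \<union> {(1, j), (2, j), (3, j)}"
  have "?S \<inter> {v. Suc j \<le> snd v} = {}" using Suc.prems(2) by fastforce
  from Suc.IH[OF frontier3_add_column[OF Suc.prems] this]
  have "real (tree_count (add_columns j g (Suc m) (1, Suc j + m) (2, Suc j + m) (3, Suc j + m))
      (card ?S + 3 * m + 3)) = readout (Suc m) a b\<^sub>1 b\<^sub>2 c d"
    unfolding add_columns_Suc_left readout_Suc .
  moreover have "card ?S = card S + 3"
    using column_notin[OF Suc.prems(2) order.refl] frontier3D(1)[OF Suc.prems(1)] by simp
  ultimately show ?case by (simp add: add_ac)
qed

lemma count_Suc:
  "count_free (Suc i) =
     8 * count_free i + 2 * count_adjacent i + 2 * count_adjacent i + count_outer i + count_all i"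
  "count_adjacent (Suc i) =
     5 * count_free i + 2 * count_adjacent i + count_adjacent i + count_outer i + count_all i"
  "count_adjacent (Suc i) =
     5 * count_free i + count_adjacent i + 2 * count_adjacent i + count_outer i + count_all i"
  "count_outer (Suc i) =
     8 * count_free i + 2 * count_adjacent i + 2 * count_adjacent i +
       3 * count_outer i + 2 * count_all i"
  "count_all (Suc i) =
     3 * count_free i + count_adjacent i + count_adjacent i + count_outer i + count_all i"
  unfolding count_free_def count_adjacent_def count_outer_def count_all_def lucas_seq.simps
  by (simp_all add: field_simps)

lemma frontier3_strip:
  "frontier3 (first_columns i) (strip i)
     (count_free i) (count_adjacent i) (count_adjacent i) (count_outer i) (count_all i)"
proof (induction i)
  case 0
  \<comment> \<open>Three vertices without edges are connected only if they are glued to one.\<close>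
  have "frontier3 {} (\<lambda>x y z :: cell. []) 0 0 0 0 1"
    by (rule frontier3I) auto
  from frontier3_verticals[OF this] show ?case
    by (simp add: first_columns_def strip_def
        count_free_def count_adjacent_def count_outer_def count_all_def)
next
  case (Suc i)
  have "first_columns i \<inter> {v. Suc i \<le> snd v} = {}" by (auto simp: first_columns_def)
  from frontier3_add_column[OF Suc this]
  have "frontier3 (first_columns i \<union> {(1, Suc i), (2, Suc i), (3, Suc i)}) (strip (Suc i))
     (count_free (Suc i)) (count_adjacent (Suc i)) (count_adjacent (Suc i))
     (count_outer (Suc i)) (count_all (Suc i))"
    unfolding strip_Suc
    by (simp only: count_Suc(1,3,4,5)) (simp only: add_ac mult_2 mult_1 numerals)
  moreover have "first_columns i \<union> {(1, Suc i), (2, Suc i), (3, Suc i)} = first_columns (Suc i)"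
    by (auto simp: first_columns_def)
  ultimately show ?case by simp
qed

lemma num_spanning_trees_grid_eq:
  "real (num_spanning_trees (grid 3 (Suc i))) = lucas_seq 3 (Suc i) * lucas_seq 5 (Suc i)"
proof -
  have "card (first_columns i) = 3 * i" by (simp add: first_columns_def)
  then show ?thesis
    using frontier3_tree_count(1)[OF frontier3_strip[of i],
        where x = "(1, Suc i)" and y = "(2, Suc i)" and z = "(3, Suc i)" and k = "3 * Suc i"]
    by (simp add: num_spanning_trees_grid grid_list_def first_columns_def count_free_def)
qed

section \<open>Deleting a vertex of an inner column\<close>

lemma degree_grid:
  assumes "v \<in> {1..a} \<times> {1..b}"
  shows "degree (grid a b) v = card {w \<in> {1..a} \<times> {1..b}. grid_adj v w}"
proof -
  let ?N = "{w \<in> {1..a} \<times> {1..b}. grid_adj v w}"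
  have sym: "grid_adj w v \<Longrightarrow> grid_adj v w" for w
    unfolding grid_adj_def by linarith
  have "{e \<in> edges (grid a b). v \<in> e} = (\<lambda>w. {v, w}) ` ?N"
  proof (intro equalityI subsetI)
    fix e assume "e \<in> {e \<in> edges (grid a b). v \<in> e}"
    then have "e \<in> edges (grid a b)" and v: "v \<in> e" by auto
    then obtain u w where e: "e = {u, w}" "u \<in> {1..a} \<times> {1..b}" "w \<in> {1..a} \<times> {1..b}" "grid_adj u w"
      by (elim grid_edgeE)
    from v e(1) consider "v = u" | "v = w" by auto
    then show "e \<in> (\<lambda>w. {v, w}) ` ?N"
    proof cases
      case 1
      then show ?thesis using e by blast
    next
      case 2
      then show ?thesis using e sym[of u]
        by (intro image_eqI[of _ _ u]) (simp_all add: insert_commute)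
    qed
  next
    fix e assume "e \<in> (\<lambda>w. {v, w}) ` ?N"
    then show "e \<in> {e \<in> edges (grid a b). v \<in> e}" using grid_edgeI[OF assms] by auto
  qed
  moreover have "inj_on (\<lambda>w. {v, w}) ?N" by (auto simp: inj_on_def doubleton_eq_iff)
  ultimately show ?thesis unfolding degree_def by (simp add: card_image)
qed

lemma degree_inner_column:
  assumes "1 < j" "j < n"
  shows "degree (grid 3 n) (1, j) = 3" "degree (grid 3 n) (2, j) = 4" "degree (grid 3 n) (3, j) = 3"
proof -
  have "{w \<in> {1..3} \<times> {1..n}. grid_adj (1, j) w} = {(2, j), (1, j - 1), (1, j + 1)}"
    using assms by (auto simp: grid_adj_def atLeastAtMost_1_3)
  then show "degree (grid 3 n) (1, j) = 3" using assms by (subst degree_grid) auto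
  have "{w \<in> {1..3} \<times> {1..n}. grid_adj (2, j) w} = {(1, j), (3, j), (2, j - 1), (2, j + 1)}"
    using assms by (auto simp: grid_adj_def atLeastAtMost_1_3)
  then show "degree (grid 3 n) (2, j) = 4" using assms by (subst degree_grid) auto
  have "{w \<in> {1..3} \<times> {1..n}. grid_adj (3, j) w} = {(2, j), (3, j - 1), (3, j + 1)}"
    using assms by (auto simp: grid_adj_def atLeastAtMost_1_3)
  then show "degree (grid 3 n) (3, j) = 3" using assms by (subst degree_grid) auto
qed

lemma avoiding_append: "avoiding v (xs @ ys) = avoiding v xs @ avoiding v ys"
  by (simp add: avoiding_def)

lemma avoiding_add_column:
  assumes "avoiding v (g (1, j) (2, j) (3, j)) = g' (1, j) (2, j) (3, j)"
    and "snd v \<noteq> j" "v \<notin> {x, y, z}"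
  shows "avoiding v (add_column j g x y z) = add_column j g' x y z"
  using assms by (auto simp: add_column_def avoiding_append) (auto simp: avoiding_def edge_Pair)

lemma avoiding_add_columns:
  assumes "\<And>x y z. v \<notin> {x, y, z} \<Longrightarrow> avoiding v (g x y z) = g' x y z" "snd v < j" "v \<notin> {x, y, z}"
  shows "avoiding v (add_columns j g m x y z) = add_columns j g' m x y z"
  using assms(3)
proof (induction m arbitrary: x y z)
  case 0
  then show ?case using assms(1) by simp
next
  case (Suc m)
  have "avoiding v (add_columns j g m (1, j + m) (2, j + m) (3, j + m)) =
      add_columns j g' m (1, j + m) (2, j + m) (3, j + m)"
    by (rule Suc.IH) (use assms(2) in auto)
  then show ?case using Suc.prems assms(2) by (auto intro!: avoiding_add_column)
qed

text \<open>
  The vertex v lies to the right of every vertex that occurs.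
\<close>

lemma avoiding_strip:
  assumes "Suc i < snd v"
  shows "avoiding v (strip i (1, Suc i) (2, Suc i) (3, Suc i)) =
    strip i (1, Suc i) (2, Suc i) (3, Suc i)"
proof -
  have "v \<notin> edge e" if "e \<in> set (strip i (1, Suc i) (2, Suc i) (3, Suc i))" for e
  proof -
    have "fst e \<in> first_columns i \<union> {(1, Suc i), (2, Suc i), (3, Suc i)}"
      "snd e \<in> first_columns i \<union> {(1, Suc i), (2, Suc i), (3, Suc i)}"
      using frontier3D(2)[OF frontier3_strip, of i "(1, Suc i)" "(2, Suc i)" "(3, Suc i)"] that
      by auto
    then show ?thesis using assms by (auto simp: edge_def first_columns_def)
  qed
  then show ?thesis by (simp add: avoiding_def filter_id_conv)
qed

text \<open>
  Column i + 2 loses the vertex v, so it is not a suitable open column; column i + 3 is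
  complete again, and h describes everything up to there.
\<close>

lemma leaf_count_via_frontier:
  assumes v: "v \<in> {1..3} \<times> {Suc (Suc i)}"
    and h: "\<And>x y z. v \<notin> {x, y, z} \<Longrightarrow> avoiding v (strip (Suc (Suc i)) x y z) = h x y z"
    and F: "frontier3 S h a b\<^sub>1 b\<^sub>2 c d"
    and S: "S \<inter> {v. Suc (Suc (Suc i)) \<le> snd v} = {}" and card: "card S = 3 * i + 5"
  shows "real (card (leaf_trees (grid 3 (i + m + 3)) v)) =
    degree (grid 3 (i + m + 3)) v * readout m a b\<^sub>1 b\<^sub>2 c d"
proof -
  let ?j = "Suc (Suc (Suc i))"
  have "grid_list (i + m + 2) =
      add_columns ?j (strip (Suc (Suc i))) m (1, ?j + m) (2, ?j + m) (3, ?j + m)"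
    using strip_add[of "Suc (Suc i)" m] by (simp add: grid_list_def add_ac numeral_2_eq_2)
  then have "avoiding v (grid_list (i + m + 2)) =
      add_columns ?j h m (1, ?j + m) (2, ?j + m) (3, ?j + m)"
    using v h by (simp only:) (intro avoiding_add_columns, auto)
  moreover have "3 * Suc (i + m + 2) - 1 = card S + 3 * m + 3" using card by simp
  moreover have "v \<in> verts (grid 3 (Suc (i + m + 2)))" using v by (auto simp: grid_def)
  ultimately have "card (leaf_trees (grid 3 (Suc (i + m + 2))) v) =
      degree (grid 3 (Suc (i + m + 2))) v *
        tree_count (add_columns ?j h m (1, ?j + m) (2, ?j + m) (3, ?j + m)) (card S + 3 * m + 3)"
    using card_leaf_trees_grid[of v "i + m + 2"] by (simp only:)
  moreover have "Suc (i + m + 2) = i + m + 3" by simp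
  ultimately show ?thesis
    using tree_count_add_columns[OF F S, of m] by (simp only: of_nat_mult)
qed

lemma card_first_columns: "card (first_columns i) = 3 * i" "finite (first_columns i)"
  by (simp_all add: first_columns_def)

lemma first_columns_Suc:
  "first_columns i \<union> {(1, Suc i), (2, Suc i), (3, Suc i)} = first_columns (Suc i)"
  by (auto simp: first_columns_def)

text \<open>
  For the first and the third row, e and f are the counts of the columns up to i + 2, of
  which the last has only two vertices, joined by an edge: e for distinct and f for glued
  vertices.
\<close>

lemma leaf_count_outer_rows:
  fixes i m
  defines "e \<equiv> 3 * count_free i + count_adjacent i"
    and "f \<equiv> 2 * count_free i + count_adjacent i"
  shows "real (card (leaf_trees (grid 3 (i + m + 3)) (1, Suc (Suc i)))) =
      3 * readout m (3 * e + f) (3 * e + f) (2 * e + f) (5 * e + 2 * f) (2 * e + f)"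
    and "real (card (leaf_trees (grid 3 (i + m + 3)) (3, Suc (Suc i)))) =
      3 * readout m (3 * e + f) (2 * e + f) (3 * e + f) (5 * e + 2 * f) (2 * e + f)"
proof -
  let ?k = "Suc i" let ?j = "Suc ?k"
  let ?A = "(1 :: nat, ?k)" let ?B = "(2 :: nat, ?k)" let ?C = "(3 :: nat, ?k)"
  have new: "?A \<notin> first_columns i" "?B \<notin> first_columns i" "?C \<notin> first_columns i"
    "?A \<noteq> ?B" "?A \<noteq> ?C" "?B \<noteq> ?C"
    by (auto simp: first_columns_def)
  have new': "(a, ?j) \<notin> first_columns ?k" for a :: nat by (simp add: first_columns_def)
  have disj: "(first_columns ?k \<union> {(a, ?j), (b, ?j)}) \<inter> {v. Suc ?j \<le> snd v} = {}" for a b :: nat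
    by (auto simp: first_columns_def)
  have card: "card (first_columns ?k \<union> {(a, ?j), (b, ?j)}) = 3 * i + 5" if "a \<noteq> b" for a b :: nat
    using that new' by (simp add: card_first_columns)
  let ?h = "\<lambda>x y z. [(x, y), (y, z)] @ [((2, ?j), y), ((3, ?j), z)] @ [((2, ?j), (3, ?j))] @
    [(?B, (2, ?j)), (?C, (3, ?j))] @ strip i ?A ?B ?C"
  have "frontier3 (first_columns ?k \<union> {(2, ?j), (3, ?j)}) ?h
      (3 * e + f) (3 * e + f) (2 * e + f) (5 * e + 2 * f) (2 * e + f)"
  proof -
    have "frontier2 (first_columns ?k) (\<lambda>x y. [(x, y)] @ [(?B, x), (?C, y)] @ strip i ?A ?B ?C) e f"
      using frontier2_vertical[OF narrow_top[OF frontier3_strip new]]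
      unfolding first_columns_Suc by (simp add: e_def f_def add_ac)
    from frontier3_verticals[OF widen_top[OF this new' new']]
    show ?thesis by (simp add: algebra_simps)
  qed
  moreover have "avoiding (1, ?j) (strip ?j x y z) = ?h x y z" if "(1, ?j) \<notin> {x, y, z}" for x y z
    using that avoiding_strip[of i "(1, ?j)"]
    by (simp add: strip_Suc add_column_def avoiding_append) (simp add: avoiding_def edge_Pair)
  moreover have "(1 :: nat, ?j) \<in> {1..3} \<times> {?j}" by simp
  ultimately have "real (card (leaf_trees (grid 3 (i + m + 3)) (1, ?j))) =
      degree (grid 3 (i + m + 3)) (1, ?j) *
        readout m (3 * e + f) (3 * e + f) (2 * e + f) (5 * e + 2 * f) (2 * e + f)"
    by (intro leaf_count_via_frontier[OF _ _ _ disj[of 2 3] card[of 2 3]]) simp_all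
  then show "real (card (leaf_trees (grid 3 (i + m + 3)) (1, Suc (Suc i)))) =
      3 * readout m (3 * e + f) (3 * e + f) (2 * e + f) (5 * e + 2 * f) (2 * e + f)"
    using degree_inner_column[of ?j "i + m + 3"] by simp
  let ?h = "\<lambda>x y z. [(x, y), (y, z)] @ [((1, ?j), x), ((2, ?j), y)] @ [((1, ?j), (2, ?j))] @
    [(?A, (1, ?j)), (?B, (2, ?j))] @ strip i ?A ?B ?C"
  have "frontier3 (first_columns ?k \<union> {(1, ?j), (2, ?j)}) ?h
      (3 * e + f) (2 * e + f) (3 * e + f) (5 * e + 2 * f) (2 * e + f)"
  proof -
    have "frontier2 (first_columns ?k) (\<lambda>x y. [(x, y)] @ [(?A, x), (?B, y)] @ strip i ?A ?B ?C) e f"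
      using frontier2_vertical[OF narrow_bottom[OF frontier3_strip new]]
      unfolding first_columns_Suc by (simp add: e_def f_def add_ac)
    from frontier3_verticals[OF widen_bottom[OF this new' new']]
    show ?thesis by (simp add: algebra_simps)
  qed
  moreover have "avoiding (3, ?j) (strip ?j x y z) = ?h x y z" if "(3, ?j) \<notin> {x, y, z}" for x y z
    using that avoiding_strip[of i "(3, ?j)"]
    by (simp add: strip_Suc add_column_def avoiding_append) (simp add: avoiding_def edge_Pair)
  moreover have "(3 :: nat, ?j) \<in> {1..3} \<times> {?j}" by simp
  ultimately have "real (card (leaf_trees (grid 3 (i + m + 3)) (3, ?j))) =
      degree (grid 3 (i + m + 3)) (3, ?j) *
        readout m (3 * e + f) (2 * e + f) (3 * e + f) (5 * e + 2 * f) (2 * e + f)"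
    by (intro leaf_count_via_frontier[OF _ _ _ disj[of 1 2] card[of 1 2]]) simp_all
  then show "real (card (leaf_trees (grid 3 (i + m + 3)) (3, Suc (Suc i)))) =
      3 * readout m (3 * e + f) (2 * e + f) (3 * e + f) (5 * e + 2 * f) (2 * e + f)"
    using degree_inner_column[of ?j "i + m + 3"] by simp
qed

text \<open>
  Without its middle vertex, column i + 2 has no edge of its own, so that here e and f come
  from the horizontal edges only.
\<close>

lemma leaf_count_middle_row:
  fixes i m
  defines "e \<equiv> count_free i"
    and "f \<equiv> 2 * count_free i + count_outer i"
  shows "real (card (leaf_trees (grid 3 (i + m + 3)) (2, Suc (Suc i)))) =
      4 * readout m (4 * e + f) (3 * e + f) (3 * e + f) (4 * e + 2 * f) (2 * e + f)"
proof -
  let ?k = "Suc i" let ?j = "Suc ?k"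
  let ?A = "(1 :: nat, ?k)" let ?B = "(2 :: nat, ?k)" let ?C = "(3 :: nat, ?k)"
  have new: "?A \<notin> first_columns i" "?B \<notin> first_columns i" "?C \<notin> first_columns i"
    "?A \<noteq> ?B" "?A \<noteq> ?C" "?B \<noteq> ?C"
    by (auto simp: first_columns_def)
  have new': "(a, ?j) \<notin> first_columns ?k" for a :: nat by (simp add: first_columns_def)
  have disj: "(first_columns ?k \<union> {(a, ?j), (b, ?j)}) \<inter> {v. Suc ?j \<le> snd v} = {}" for a b :: nat
    by (auto simp: first_columns_def)
  have card: "card (first_columns ?k \<union> {(a, ?j), (b, ?j)}) = 3 * i + 5" if "a \<noteq> b" for a b :: nat
    using that new' by (simp add: card_first_columns)
  let ?h = "\<lambda>x y z. [(x, y), (y, z)] @ [((1, ?j), x), ((3, ?j), z)] @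
    [(?A, (1, ?j)), (?C, (3, ?j))] @ strip i ?A ?B ?C"
  have "frontier3 (first_columns ?k \<union> {(1, ?j), (3, ?j)}) ?h
      (4 * e + f) (3 * e + f) (3 * e + f) (4 * e + 2 * f) (2 * e + f)"
  proof -
    have "frontier2 (first_columns ?k) (\<lambda>x y. [(?A, x), (?C, y)] @ strip i ?A ?B ?C) e f"
      using narrow_middle[OF frontier3_strip new]
      unfolding first_columns_Suc by (simp add: e_def f_def add_ac)
    from frontier3_verticals[OF widen_middle[OF this new' new']]
    show ?thesis by (simp add: algebra_simps)
  qed
  moreover have "avoiding (2, ?j) (strip ?j x y z) = ?h x y z" if "(2, ?j) \<notin> {x, y, z}" for x y z
    using that avoiding_strip[of i "(2, ?j)"]
    by (simp add: strip_Suc add_column_def avoiding_append) (simp add: avoiding_def edge_Pair)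
  moreover have "(2 :: nat, ?j) \<in> {1..3} \<times> {?j}" by simp
  ultimately have "real (card (leaf_trees (grid 3 (i + m + 3)) (2, ?j))) =
      degree (grid 3 (i + m + 3)) (2, ?j) *
        readout m (4 * e + f) (3 * e + f) (3 * e + f) (4 * e + 2 * f) (2 * e + f)"
    by (intro leaf_count_via_frontier[OF _ _ _ disj[of 1 3] card[of 1 3]]) simp_all
  then show "real (card (leaf_trees (grid 3 (i + m + 3)) (2, Suc (Suc i)))) =
      4 * readout m (4 * e + f) (3 * e + f) (3 * e + f) (4 * e + 2 * f) (2 * e + f)"
    using degree_inner_column[of ?j "i + m + 3"] by simp
qed

section \<open>The limiting fraction of leaves\<close>

definition column_leaves :: "nat \<Rightarrow> nat \<Rightarrow> real" where
  "column_leaves n j = (\<Sum>r\<in>{1, 2, 3}. real (card (leaf_trees (grid 3 n) (r, j))))"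

text \<open>
  The coefficients collect the readouts of the two outer rows, each with degree 3, and of the
  middle row, with degree 4.
\<close>

lemma inner_column_leaves:
  "column_leaves (i + m + 3) (i + 2) =
     count_all m * (90 * count_free i + 24 * count_adjacent i + 4 * count_outer i) +
     weight_adjacent m * (154 * count_free i + 42 * count_adjacent i + 8 * count_outer i) +
     weight_outer m * (146 * count_free i + 42 * count_adjacent i + 8 * count_outer i) +
     weight_all m * (64 * count_free i + 18 * count_adjacent i + 4 * count_outer i)"
proof -
  have "column_leaves (i + m + 3) (i + 2) =
      real (card (leaf_trees (grid 3 (i + m + 3)) (1, Suc (Suc i)))) +
      real (card (leaf_trees (grid 3 (i + m + 3)) (2, Suc (Suc i)))) +
      real (card (leaf_trees (grid 3 (i + m + 3)) (3, Suc (Suc i))))"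
    by (simp add: column_leaves_def numeral_2_eq_2 numeral_3_eq_3)
  then show ?thesis
    unfolding leaf_count_outer_rows leaf_count_middle_row readout_def by (simp add: algebra_simps)
qed

lemma column_leaves_bounds:
  "0 \<le> column_leaves n j" "column_leaves n j \<le> 3 * real (num_spanning_trees (grid 3 n))"
proof -
  have le: "real (card (leaf_trees (grid 3 n) v)) \<le> real (num_spanning_trees (grid 3 n))" for v
    using card_leaf_trees_le[OF simple_graph_grid] by simp
  show "column_leaves n j \<le> 3 * real (num_spanning_trees (grid 3 n))"
    using le[of "(1, j)"] le[of "(2, j)"] le[of "(3, j)"] by (simp add: column_leaves_def)
qed (simp add: column_leaves_def)

lemma verts_grid: "verts (grid a b) = {1..a} \<times> {1..b}"
  by (simp add: grid_def)

lemma sum_card_leaves_grid: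
  "real (\<Sum>T\<in>spanning_trees (grid 3 (k + 3)). card (leaves T)) =
     column_leaves (k + 3) 1 + column_leaves (k + 3) (k + 3) +
     (\<Sum>i<Suc k. column_leaves (k + 3) (i + 2))"
proof -
  let ?G = "grid 3 (k + 3)" and ?n = "k + 3"
  have "real (\<Sum>T\<in>spanning_trees ?G. card (leaves T)) =
      (\<Sum>v\<in>{1..3} \<times> {1..?n}. real (card (leaf_trees ?G v)))"
    unfolding sum_card_leaves[OF simple_graph_grid] verts_grid of_nat_sum by (rule refl)
  also have "\<dots> = (\<Sum>r\<in>{1..3}. \<Sum>j\<in>{1..?n}. real (card (leaf_trees ?G (r, j))))"
    by (simp only: sum.cartesian_product case_prod_unfold prod.collapse)
  also have "\<dots> = (\<Sum>j\<in>{1..?n}. \<Sum>r\<in>{1..3}. real (card (leaf_trees ?G (r, j))))"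
    by (rule sum.swap)
  also have "\<dots> = (\<Sum>j\<in>{1..?n}. column_leaves ?n j)"
    by (simp only: column_leaves_def atLeastAtMost_1_3)
  also have "{1..?n} = insert 1 (insert ?n ((\<lambda>i. i + 2) ` {..<Suc k}))"
  proof (intro equalityI subsetI)
    fix j assume "j \<in> {1..?n}"
    then have "j = 1 \<or> j = ?n \<or> (j - 2 < Suc k \<and> j = j - 2 + 2)" by auto
    then show "j \<in> insert 1 (insert ?n ((\<lambda>i. i + 2) ` {..<Suc k}))" by blast
  qed auto
  also have "(\<Sum>j\<in>insert 1 (insert ?n ((\<lambda>i. i + 2) ` {..<Suc k})). column_leaves ?n j) =
      column_leaves ?n 1 + (column_leaves ?n ?n +
        (\<Sum>j\<in>(\<lambda>i. i + 2) ` {..<Suc k}. column_leaves ?n j))"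
    by (subst sum.insert; (subst sum.insert)?) auto
  also have "(\<Sum>j\<in>(\<lambda>i. i + 2) ` {..<Suc k}. column_leaves ?n j) =
      (\<Sum>i<Suc k. column_leaves ?n (i + 2))"
    by (subst sum.reindex) (auto simp: inj_on_def)
  finally show ?thesis by (simp only: add.assoc)
qed

text \<open>
  Along the family the number of vertices a * n determines n, so that the two limits agree.
\<close>

lemma is_BZ_constant_grid:
  assumes "(\<lambda>n. bz_ratio (grid a n)) \<longlonglongrightarrow> c" and "a \<ge> 1"
  shows "is_BZ_constant {grid a n | n. n \<ge> 1} c"
  unfolding is_BZ_constant_def
proof (intro conjI allI)
  fix N
  have "N \<le> card (verts (grid a (Suc N)))"
    using assms(2) by (simp add: card_verts_grid trans_le_add2)
  then show "\<exists>G\<in>{grid a n | n. n \<ge> 1}. N \<le> card (verts G)"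
    by (intro bexI[of _ "grid a (Suc N)"]) auto
next
  show "(bz_ratio \<longlongrightarrow> c)
    (inf (filtercomap (\<lambda>G. card (verts G)) at_top) (principal {grid a n | n. n \<ge> 1}))"
  proof (rule topological_tendstoI)
    fix S :: "real set" assume "open S" "c \<in> S"
    then obtain N where N: "\<And>n. n \<ge> N \<Longrightarrow> bz_ratio (grid a n) \<in> S"
      using topological_tendstoD[OF assms(1)] by (auto simp: eventually_sequentially)
    have "bz_ratio G \<in> S" if G: "G \<in> {grid a n | n. n \<ge> 1}" "a * N \<le> card (verts G)" for G
    proof -
      obtain n where n: "G = grid a n" using G(1) by blast
      then have "N \<le> n" using G(2) assms(2) by (simp add: card_verts_grid)
      then show ?thesis using N n by simp
    qed
    then show "\<forall>\<^sub>F G in inf (filtercomap (\<lambda>G. card (verts G)) at_top)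
        (principal {grid a n | n. n \<ge> 1}).
        bz_ratio G \<in> S"
      unfolding eventually_inf_principal eventually_filtercomap_at_top_linorder by blast
  qed
qed

text \<open>
  The growth rates \<open>\<alpha>\<close> and \<open>\<beta>\<close> of the two recursive sequences satisfy \<open>\<alpha> + 1 / \<alpha> = 3\<close>, \<open>\<alpha> - 1 / \<alpha> =
  s\<close>, \<open>\<beta> + 1 / \<beta> = 5\<close> and \<open>\<beta> - 1 / \<beta> = t\<close>.
\<close>

context
  fixes s t \<alpha> \<beta> :: real
  defines "s \<equiv> sqrt 5" and "t \<equiv> sqrt 21" and "\<alpha> \<equiv> (3 + sqrt 5) / 2" and "\<beta> \<equiv> (5 + sqrt 21) / 2"
begin

lemma squares: "s * s = 5" "t * t = 21"
  by (simp_all add: s_def t_def)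

lemma squares_left: "s * (s * x) = 5 * x" "t * (t * x) = 21 * x"
  by (simp_all only: mult.assoc[symmetric] squares)

lemma s_t_pos: "s > 0" "t > 0"
  by (simp_all add: s_def t_def)

lemma root_inverses: "1 / \<alpha> = (3 - s) / 2" "1 / \<beta> = (5 - t) / 2"
proof -
  have "\<alpha> * ((3 - s) / 2) = 1" "\<beta> * ((5 - t) / 2) = 1"
    using squares by (simp_all add: \<alpha>_def \<beta>_def s_def[symmetric] t_def[symmetric] field_simps)
  then show "1 / \<alpha> = (3 - s) / 2" "1 / \<beta> = (5 - t) / 2"
    by (metis mult_eq_0_iff nonzero_mult_div_cancel_left zero_neq_one)+
qed

lemma roots_gt_1: "\<alpha> > 1" "\<beta> > 1"
proof -
  show "\<alpha> > 1" by (simp add: \<alpha>_def add_pos_pos)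
  show "\<beta> > 1" by (simp add: \<beta>_def add_pos_pos)
qed

lemma lucas_limits:
  "(\<lambda>n. lucas_seq 3 n / \<alpha> ^ n) \<longlonglongrightarrow> 1 / s" "(\<lambda>n. lucas_seq 3 (Suc n) / \<alpha> ^ n) \<longlonglongrightarrow> \<alpha> / s"
  "(\<lambda>n. lucas_seq 5 n / \<beta> ^ n) \<longlonglongrightarrow> 1 / t" "(\<lambda>n. lucas_seq 5 (Suc n) / \<beta> ^ n) \<longlonglongrightarrow> \<beta> / t"
proof -
  have "\<alpha> + 1 / \<alpha> = 3" "\<alpha> - 1 / \<alpha> = s" "\<beta> + 1 / \<beta> = 5" "\<beta> - 1 / \<beta> = t"
    unfolding root_inverses by (simp_all add: \<alpha>_def \<beta>_def s_def t_def field_simps)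
  then show "(\<lambda>n. lucas_seq 3 n / \<alpha> ^ n) \<longlonglongrightarrow> 1 / s" "(\<lambda>n. lucas_seq 3 (Suc n) / \<alpha> ^ n) \<longlonglongrightarrow> \<alpha> / s"
    "(\<lambda>n. lucas_seq 5 n / \<beta> ^ n) \<longlonglongrightarrow> 1 / t" "(\<lambda>n. lucas_seq 5 (Suc n) / \<beta> ^ n) \<longlonglongrightarrow> \<beta> / t"
    using lucas_seq_asymp[OF roots_gt_1(1)] lucas_seq_asymp[OF roots_gt_1(2)] by simp_all
qed

lemma product_limit:
  assumes "(\<lambda>n. x n / \<alpha> ^ n) \<longlonglongrightarrow> a" "(\<lambda>n. y n / \<beta> ^ n) \<longlonglongrightarrow> b"
  shows "(\<lambda>n. x n * y n / (\<alpha> * \<beta>) ^ n) \<longlonglongrightarrow> a * b"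
  using tendsto_mult[OF assms] by (simp add: power_mult_distrib)

lemma count_limits:
  "(\<lambda>n. count_free n / (\<alpha> * \<beta>) ^ n) \<longlonglongrightarrow> \<alpha> * \<beta> / (s * t)"
  "(\<lambda>n. count_adjacent n / (\<alpha> * \<beta>) ^ n) \<longlonglongrightarrow> (\<alpha> * \<beta> - (\<alpha> + \<beta>) / 2) / (s * t)"
  "(\<lambda>n. count_outer n / (\<alpha> * \<beta>) ^ n) \<longlonglongrightarrow> (2 * \<alpha> * \<beta> - 2 * \<beta>) / (s * t)"
  "(\<lambda>n. count_all n / (\<alpha> * \<beta>) ^ n) \<longlonglongrightarrow> (\<alpha> - 1) * (\<beta> - 1) / (s * t)"
  "(\<lambda>n. weight_adjacent n / (\<alpha> * \<beta>) ^ n) \<longlonglongrightarrow> (\<alpha> - 1) / (s * t)"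
  "(\<lambda>n. weight_outer n / (\<alpha> * \<beta>) ^ n) \<longlonglongrightarrow> (\<beta> - \<alpha>) / (2 * (s * t))"
  "(\<lambda>n. weight_all n / (\<alpha> * \<beta>) ^ n) \<longlonglongrightarrow> 1 / (s * t)"
proof -
  define PQ pQ Pq pq where "PQ = (\<lambda>n. lucas_seq 3 (Suc n) * lucas_seq 5 (Suc n) / (\<alpha> * \<beta>) ^ n)"
    and "pQ = (\<lambda>n. lucas_seq 3 n * lucas_seq 5 (Suc n) / (\<alpha> * \<beta>) ^ n)"
    and "Pq = (\<lambda>n. lucas_seq 3 (Suc n) * lucas_seq 5 n / (\<alpha> * \<beta>) ^ n)"
    and "pq = (\<lambda>n. lucas_seq 3 n * lucas_seq 5 n / (\<alpha> * \<beta>) ^ n)"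
  have lim: "PQ \<longlonglongrightarrow> \<alpha> * \<beta> / (s * t)" "pQ \<longlonglongrightarrow> \<beta> / (s * t)" "Pq \<longlonglongrightarrow> \<alpha> / (s * t)" "pq \<longlonglongrightarrow> 1 / (s * t)"
    unfolding PQ_def pQ_def Pq_def pq_def
    using product_limit[OF lucas_limits(2,4)] product_limit[OF lucas_limits(1,4)]
      product_limit[OF lucas_limits(2,3)] product_limit[OF lucas_limits(1,3)] by simp_all
  note defs = PQ_def pQ_def Pq_def pq_def
  have combine: "(\<lambda>n. (u * (lucas_seq 3 (Suc n) * lucas_seq 5 (Suc n)) +
      v * (lucas_seq 3 n * lucas_seq 5 (Suc n)) +
      w * (lucas_seq 3 (Suc n) * lucas_seq 5 n) + z * (lucas_seq 3 n * lucas_seq 5 n)) /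
        (\<alpha> * \<beta>) ^ n) \<longlonglongrightarrow> (u * (\<alpha> * \<beta>) + v * \<beta> + w * \<alpha> + z) / (s * t)" for u v w z
  proof -
    have "(\<lambda>n. u * PQ n + v * pQ n + w * Pq n + z * pq n) \<longlonglongrightarrow>
        u * (\<alpha> * \<beta> / (s * t)) + v * (\<beta> / (s * t)) + w * (\<alpha> / (s * t)) + z * (1 / (s * t))"
      by (intro tendsto_add tendsto_mult tendsto_const lim)
    then show ?thesis by (simp add: defs add_divide_distrib)
  qed
  show "(\<lambda>n. count_free n / (\<alpha> * \<beta>) ^ n) \<longlonglongrightarrow> \<alpha> * \<beta> / (s * t)"
    using combine[of 1 0 0 0] by (simp add: count_free_def)
  show "(\<lambda>n. count_adjacent n / (\<alpha> * \<beta>) ^ n) \<longlonglongrightarrow> (\<alpha> * \<beta> - (\<alpha> + \<beta>) / 2) / (s * t)"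
    using combine[of 1 "- 1 / 2" "- 1 / 2" 0]
    by (simp add: count_adjacent_def algebra_simps add_divide_distrib)
  show "(\<lambda>n. count_outer n / (\<alpha> * \<beta>) ^ n) \<longlonglongrightarrow> (2 * \<alpha> * \<beta> - 2 * \<beta>) / (s * t)"
    using combine[of 2 "- 2" 0 0] by (simp add: count_outer_def algebra_simps)
  show "(\<lambda>n. count_all n / (\<alpha> * \<beta>) ^ n) \<longlonglongrightarrow> (\<alpha> - 1) * (\<beta> - 1) / (s * t)"
    using combine[of 1 "- 1" "- 1" 1] by (simp add: count_all_def algebra_simps)
  show "(\<lambda>n. weight_adjacent n / (\<alpha> * \<beta>) ^ n) \<longlonglongrightarrow> (\<alpha> - 1) / (s * t)"
    using combine[of 0 0 1 "- 1"] by (simp add: weight_adjacent_def algebra_simps)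
  show "(\<lambda>n. weight_outer n / (\<alpha> * \<beta>) ^ n) \<longlonglongrightarrow> (\<beta> - \<alpha>) / (2 * (s * t))"
    using combine[of 0 "1 / 2" "- 1 / 2" 0] by (simp add: weight_outer_def field_simps)
  show "(\<lambda>n. weight_all n / (\<alpha> * \<beta>) ^ n) \<longlonglongrightarrow> 1 / (s * t)"
    using combine[of 0 0 0 1] by (simp add: weight_all_def)
qed

text \<open>
  The columns on the two sides of column i + 2 enter through the indices i and k - i, so that
  the sum over i is a sum of four convolutions, one for each term of \<open>readout\<close>.
\<close>

lemma inner_leaves_limit:
  "(\<lambda>k. (\<Sum>i<Suc k. column_leaves (k + 3) (i + 2)) / (real (Suc k) * (\<alpha> * \<beta>) ^ k)) \<longlonglongrightarrow>
     ((\<alpha> - 1) * (\<beta> - 1) * (90 * \<alpha> * \<beta> + 24 * (\<alpha> * \<beta> - (\<alpha> + \<beta>) / 2) + 4 * (2 * \<alpha> * \<beta> - 2 * \<beta>)) +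
      (\<alpha> - 1) * (154 * \<alpha> * \<beta> + 42 * (\<alpha> * \<beta> - (\<alpha> + \<beta>) / 2) + 8 * (2 * \<alpha> * \<beta> - 2 * \<beta>)) +
      (\<beta> - \<alpha>) / 2 * (146 * \<alpha> * \<beta> + 42 * (\<alpha> * \<beta> - (\<alpha> + \<beta>) / 2) + 8 * (2 * \<alpha> * \<beta> - 2 * \<beta>)) +
      (64 * \<alpha> * \<beta> + 18 * (\<alpha> * \<beta> - (\<alpha> + \<beta>) / 2) + 4 * (2 * \<alpha> * \<beta> - 2 * \<beta>))) / (s * t)\<^sup>2"
  (is "?f \<longlonglongrightarrow> _")
proof -
  define comb where
    "comb u v w i = u * count_free i + v * count_adjacent i + w * count_outer i" for u v w i
  define num where
    "num u v w = u * \<alpha> * \<beta> + v * (\<alpha> * \<beta> - (\<alpha> + \<beta>) / 2) + w * (2 * \<alpha> * \<beta> - 2 * \<beta>)" for u v w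
  have comb: "(\<lambda>i. comb u v w i / (\<alpha> * \<beta>) ^ i) \<longlonglongrightarrow> num u v w / (s * t)" for u v w
  proof -
    have "(\<lambda>i. u * (count_free i / (\<alpha> * \<beta>) ^ i) + v * (count_adjacent i / (\<alpha> * \<beta>) ^ i) +
        w * (count_outer i / (\<alpha> * \<beta>) ^ i)) \<longlonglongrightarrow>
        u * (\<alpha> * \<beta> / (s * t)) + v * ((\<alpha> * \<beta> - (\<alpha> + \<beta>) / 2) / (s * t)) +
        w * ((2 * \<alpha> * \<beta> - 2 * \<beta>) / (s * t))"
      by (intro tendsto_add tendsto_mult tendsto_const count_limits)
    then show ?thesis by (simp add: comb_def num_def add_divide_distrib mult.assoc)
  qed
  have pos: "\<alpha> * \<beta> > 0" using roots_gt_1 by simp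
  note conv = power_weighted_convolution_tendsto[OF pos comb]
  let ?c = "\<lambda>y x k. (\<Sum>i<Suc k. y (k - i) * x i) / (real (Suc k) * (\<alpha> * \<beta>) ^ k)"
  have "?f = (\<lambda>k. ?c count_all (comb 90 24 4) k + ?c weight_adjacent (comb 154 42 8) k +
      ?c weight_outer (comb 146 42 8) k + ?c weight_all (comb 64 18 4) k)"
  proof
    fix k
    have "column_leaves (k + 3) (i + 2) =
        count_all (k - i) * comb 90 24 4 i + weight_adjacent (k - i) * comb 154 42 8 i +
        weight_outer (k - i) * comb 146 42 8 i + weight_all (k - i) * comb 64 18 4 i"
      if "i < Suc k" for i
      using inner_column_leaves[of i "k - i"] that by (simp add: comb_def)
    then have "(\<Sum>i<Suc k. column_leaves (k + 3) (i + 2)) =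
        (\<Sum>i<Suc k. count_all (k - i) * comb 90 24 4 i + weight_adjacent (k - i) * comb 154 42 8 i +
        weight_outer (k - i) * comb 146 42 8 i + weight_all (k - i) * comb 64 18 4 i)"
      by (intro sum.cong) auto
    then show "?f k = ?c count_all (comb 90 24 4) k + ?c weight_adjacent (comb 154 42 8) k +
      ?c weight_outer (comb 146 42 8) k + ?c weight_all (comb 64 18 4) k"
      by (simp only: sum.distrib add_divide_distrib)
  qed
  moreover have "(\<lambda>k. ?c count_all (comb 90 24 4) k + ?c weight_adjacent (comb 154 42 8) k +
      ?c weight_outer (comb 146 42 8) k + ?c weight_all (comb 64 18 4) k) \<longlonglongrightarrow>
      (\<alpha> - 1) * (\<beta> - 1) / (s * t) * (num 90 24 4 / (s * t)) +
      (\<alpha> - 1) / (s * t) * (num 154 42 8 / (s * t)) +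
      (\<beta> - \<alpha>) / (2 * (s * t)) * (num 146 42 8 / (s * t)) + 1 / (s * t) * (num 64 18 4 / (s * t))"
    by (intro tendsto_add conv count_limits)
  moreover have "(\<alpha> - 1) * (\<beta> - 1) / (s * t) * (num 90 24 4 / (s * t)) +
      (\<alpha> - 1) / (s * t) * (num 154 42 8 / (s * t)) +
      (\<beta> - \<alpha>) / (2 * (s * t)) * (num 146 42 8 / (s * t)) + 1 / (s * t) * (num 64 18 4 / (s * t)) =
      ((\<alpha> - 1) * (\<beta> - 1) * num 90 24 4 + (\<alpha> - 1) * num 154 42 8 +
        (\<beta> - \<alpha>) / 2 * num 146 42 8 + num 64 18 4) / (s * t)\<^sup>2"
    by (simp add: power2_eq_square add_divide_distrib)
  ultimately show ?thesis unfolding num_def by (simp only:)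
qed

text \<open>
  The number of spanning trees of k + 3 columns grows like the power k + 3 of \<open>\<alpha> * \<beta>\<close>. The two
  sides of an inner column contribute only the exponents i and k - i, which leaves a factor
  of exponent 3.
\<close>

lemma num_spanning_trees_limit:
  "(\<lambda>k. (\<alpha> * \<beta>) ^ k / real (num_spanning_trees (grid 3 (k + 3)))) \<longlonglongrightarrow>
     s * t * (1 / \<alpha>) ^ 3 * (1 / \<beta>) ^ 3"
proof -
  have pos: "\<alpha> * \<beta> > 0" "\<alpha> \<noteq> 0" "\<beta> \<noteq> 0" using roots_gt_1 by simp_all
  have "(\<lambda>k. count_free (k + 2) / (\<alpha> * \<beta>) ^ (k + 2)) \<longlonglongrightarrow> \<alpha> * \<beta> / (s * t)"
    using LIMSEQ_ignore_initial_segment[OF count_limits(1), of 2] .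
  then have "(\<lambda>k. inverse (count_free (k + 2) / (\<alpha> * \<beta>) ^ (k + 2)) * (1 / (\<alpha> * \<beta>) ^ 2)) \<longlonglongrightarrow>
      inverse (\<alpha> * \<beta> / (s * t)) * (1 / (\<alpha> * \<beta>) ^ 2)"
    using s_t_pos pos by (intro tendsto_mult tendsto_inverse tendsto_const) auto
  moreover have "inverse (count_free (k + 2) / (\<alpha> * \<beta>) ^ (k + 2)) * (1 / (\<alpha> * \<beta>) ^ 2) =
      (\<alpha> * \<beta>) ^ k / real (num_spanning_trees (grid 3 (k + 3)))" for k
  proof -
    have "Suc (k + 2) = k + 3" by simp
    then have "count_free (k + 2) = real (num_spanning_trees (grid 3 (k + 3)))"
      unfolding count_free_def by (metis num_spanning_trees_grid_eq)
    moreover have "inverse (N / (A * B)) * (1 / B) = A / N" if "B \<noteq> 0" for N A B :: real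
      using that by simp
    ultimately show ?thesis using pos by (simp only: power_add) simp
  qed
  moreover have "inverse (\<alpha> * \<beta> / (s * t)) * (1 / (\<alpha> * \<beta>) ^ 2) = s * t * (1 / \<alpha>) ^ 3 * (1 / \<beta>) ^ 3"
    using pos by (simp add: field_simps power2_eq_square power3_eq_cube)
  ultimately show ?thesis by simp
qed

text \<open>
  Both radicands are squares because \<open>(5 - sqrt 21)\<^sup>2 = 2 * (23 - 5 * sqrt 21)\<close>.
\<close>

lemma sqrt_denesting:
  "sqrt (230 - 50 * sqrt 21) = s * (5 - t)" "sqrt (210 * (23 - 5 * sqrt 21)) = s * t * (5 - t)"
proof -
  have t5: "5 - t \<ge> 0"
    unfolding t_def using real_sqrt_le_mono[of 21 25] by simp
  have "(s * (5 - t))\<^sup>2 = 230 - 50 * t" "(s * t * (5 - t))\<^sup>2 = 210 * (23 - 5 * t)"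
    by (simp_all add: power2_eq_square algebra_simps squares squares_left)
  then show "sqrt (230 - 50 * sqrt 21) = s * (5 - t)"
    "sqrt (210 * (23 - 5 * sqrt 21)) = s * t * (5 - t)"
    using t5 s_t_pos unfolding t_def[symmetric] by (auto intro!: real_sqrt_unique)
qed

text \<open>
  Multiplying by s * t and replacing the cubes of \<open>1 / \<alpha>\<close> and \<open>1 / \<beta>\<close> by linear expressions in s
  and t leaves an identity of polynomials modulo \<open>s\<^sup>2 = 5\<close> and \<open>t\<^sup>2 = 21\<close>.
\<close>

lemma leaf_constant:
  defines "num \<equiv> (\<lambda>u v w. u * \<alpha> * \<beta> + v * (\<alpha> * \<beta> - (\<alpha> + \<beta>) / 2) + w * (2 * \<alpha> * \<beta> - 2 * \<beta>))"
  shows "((\<alpha> - 1) * (\<beta> - 1) * num 90 24 4 + (\<alpha> - 1) * num 154 42 8 +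
        (\<beta> - \<alpha>) / 2 * num 146 42 8 + num 64 18 4) /
      (s * t)\<^sup>2 * (s * t * (1 / \<alpha>) ^ 3 * (1 / \<beta>) ^ 3) / 3 =
    (- 10500 + 2200 * sqrt 21 + 1197 * sqrt (230 - 50 * sqrt 21) +
      149 * sqrt (210 * (23 - 5 * sqrt 21))) / 5040"
    (is "?Q / _ * _ / 3 = ?c")
proof -
  have ab: "\<alpha> = (3 + s) / 2" "\<beta> = (5 + t) / 2" by (simp_all add: \<alpha>_def \<beta>_def s_def t_def)
  have inv: "(1 / \<alpha>) ^ 3 = 9 - 4 * s" "(1 / \<beta>) ^ 3 = 55 - 12 * t"
    unfolding root_inverses power_divide
    by (simp_all add: power3_eq_cube algebra_simps squares squares_left diff_divide_distrib)
  have c: "?c = (- 10500 + 2200 * t + 2856 * s - 452 * (s * t)) / 5040"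
    unfolding sqrt_denesting unfolding t_def[symmetric]
    by (simp add: algebra_simps squares squares_left)
  have key: "?Q * ((9 - 4 * s) * (55 - 12 * t)) =
      s * t * 3 * ((- 10500 + 2200 * t + 2856 * s - 452 * (s * t)) / 5040)"
    unfolding num_def ab
    by (simp add: add_divide_distrib diff_divide_distrib algebra_simps squares squares_left)
  have clear: "Q / D\<^sup>2 * (D * x * y) / 3 = R"
    if "Q * (x * y) = D * 3 * R" "D \<noteq> 0" for Q D x y R :: real
  proof -
    have "Q / D\<^sup>2 * (D * x * y) / 3 = Q * (x * y) / (3 * D)" by (simp add: power2_eq_square)
    then show ?thesis using that by simp
  qed
  show ?thesis unfolding inv c by (rule clear[OF key]) (use s_t_pos in simp)
qed

text \<open>
  The inner columns carry the limit, and the two outermost ones vanish because each of them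
  has at most three leaves per tree while the denominator has a factor n.
\<close>

lemma leaf_fraction_limit:
  "(\<lambda>n. real (\<Sum>T\<in>spanning_trees (grid 3 n). card (leaves T)) /
      (3 * real n * real (num_spanning_trees (grid 3 n)))) \<longlonglongrightarrow>
    (- 10500 + 2200 * sqrt 21 + 1197 * sqrt (230 - 50 * sqrt 21) +
      149 * sqrt (210 * (23 - 5 * sqrt 21))) / 5040"
  (is "?r \<longlonglongrightarrow> ?c")
proof (rule LIMSEQ_offset[of _ 3])
  let ?\<tau> = "\<lambda>k. real (num_spanning_trees (grid 3 (k + 3)))"
  let ?M = "\<lambda>k. \<Sum>i<Suc k. column_leaves (k + 3) (i + 2)"
  let ?E = "\<lambda>k. column_leaves (k + 3) 1 + column_leaves (k + 3) (k + 3)"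
  \<comment> \<open>The shift by 3 makes column 2 the first and column k + 2 the last inner column.\<close>
  let ?inner = "\<lambda>k. ?M k / (real (Suc k) * (\<alpha> * \<beta>) ^ k) * ((\<alpha> * \<beta>) ^ k / ?\<tau> k) / 3 *
    (real (Suc k) / real (k + 3))"
  let ?outer = "\<lambda>k. ?E k / (3 * real (k + 3) * ?\<tau> k)"
  have lim0: "(\<lambda>k. 2 / real (k + 3)) \<longlonglongrightarrow> 0"
    by (rule LIMSEQ_ignore_initial_segment[OF lim_const_over_n])
  have "(\<lambda>k. 1 - 2 / real (k + 3)) \<longlonglongrightarrow> 1 - 0"
    by (rule tendsto_diff[OF tendsto_const lim0])
  moreover have "1 - 2 / real (k + 3) = real (Suc k) / real (k + 3)" for k
    by (simp add: field_simps)
  ultimately have "(\<lambda>k. real (Suc k) / real (k + 3)) \<longlonglongrightarrow> 1" by simp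
  then have inner: "?inner \<longlonglongrightarrow> ?c"
    using tendsto_mult[OF tendsto_divide[OF
        tendsto_mult[OF inner_leaves_limit num_spanning_trees_limit] tendsto_const[of 3]]]
    unfolding leaf_constant by fastforce
  have outer: "?outer \<longlonglongrightarrow> 0"
  proof (rule tendsto_sandwich)
    show "(\<lambda>k. 0) \<longlonglongrightarrow> (0 :: real)" by simp
    show "(\<lambda>k. 2 / real (k + 3)) \<longlonglongrightarrow> 0" by (rule lim0)
    show "\<forall>\<^sub>F k in sequentially. 0 \<le> ?outer k"
      by (intro always_eventually allI divide_nonneg_nonneg) (simp_all add: column_leaves_bounds(1))
    show "\<forall>\<^sub>F k in sequentially. ?outer k \<le> 2 / real (k + 3)"
    proof (intro always_eventually allI)
      fix k
      have "?E k \<le> 6 * ?\<tau> k"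
        using column_leaves_bounds(2)[of "k + 3" 1]
          column_leaves_bounds(2)[of "k + 3" "k + 3"] by linarith
      then have "?outer k \<le> 6 * ?\<tau> k / (3 * real (k + 3) * ?\<tau> k)"
        by (rule divide_right_mono) simp
      also have "\<dots> \<le> 2 / real (k + 3)"
      proof -
        have "6 * T / (3 * n * T) \<le> 2 / n" if "n \<ge> 0" for n T :: real
          using that by (cases "T = 0") simp_all
        then show ?thesis by (simp only: of_nat_0_le_iff)
      qed
      finally show "?outer k \<le> 2 / real (k + 3)" .
    qed
  qed
  have "?r (k + 3) = ?inner k + ?outer k" for k
  proof -
    have "(\<alpha> * \<beta>) ^ k \<noteq> 0" using roots_gt_1 by simp
    moreover have "M / (n * x) * (x / T) / 3 * (n / n') = M / (3 * n' * T)"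
      if "x \<noteq> 0" "n \<noteq> 0" for M n x T n' :: real
      using that by simp
    ultimately have "?inner k = ?M k / (3 * real (k + 3) * ?\<tau> k)" by simp
    then show ?thesis unfolding sum_card_leaves_grid by (simp only: add_divide_distrib add.commute)
  qed
  then show "(\<lambda>k. ?r (k + 3)) \<longlonglongrightarrow> ?c"
    using tendsto_add[OF inner outer] by simp
qed

end

theorem theorem7p0p3:
  shows "let c = (- 10500 + 2200 * sqrt 21 + 1197 * sqrt (230 - 50 * sqrt 21)
                  + 149 * sqrt (210 * (23 - 5 * sqrt 21))) / 5040
         in is_BZ_constant {grid 3 n | n. n \<ge> 1} c \<and>
            (\<lambda>n. real (\<Sum>T\<in>spanning_trees (grid 3 n). card (leaves T)) /
                  (3 * real n * real (num_spanning_trees (grid 3 n)))) \<longlonglongrightarrow> c"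
proof -
  have "bz_ratio (grid 3 n) = real (\<Sum>T\<in>spanning_trees (grid 3 n). card (leaves T)) /
      (3 * real n * real (num_spanning_trees (grid 3 n)))" for n
    by (simp add: bz_ratio_def card_verts_grid)
  then show ?thesis
    using leaf_fraction_limit is_BZ_constant_grid[of 3] by (simp add: Let_def)
qed

end
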